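(* Let $h$ be a smooth function of $s$ and consider the rotation hypersurface in $S^m\times\mathbb{R}$ given by $$f(s,v_1,\dots,v_{m-1})=\big(\cos s,\ \varphi_1(v_1,\dots,v_{m-1})\sin s,\ \dots,\ \varphi_m(v_1,\dots,v_{m-1})\sin s,\ h(s)\big),$$ where $\varphi=(\varphi_1,\dots,\varphi_m)$ is an orthogonal parametrization of the unit sphere $S^{m-1}\subset\mathbb{R}^m$. Let $u=-\sin\alpha$. This rotation hypersurface is biharmonic if its mean curvature function $H=\frac1m\big(u'+(m-1)u\cot s\big)$ solves the equations $$\Big(3u'+(m-1)u\cot s\Big)H'+2(m-1)uH=0,$$ $$(1-u^2)H''+\Big((m-1)(1-u^2)\cot s-uu'\Big)H'+\Big((m-1)u^2(1-\cot^2 s)-u'^2\Big)H=0.$$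
   Context: $S^m\times\mathbb{R}\subset\mathbb{R}^{m+1}\times\mathbb{R}$ has the product metric, with $S^m$ the unit sphere. The profile curve is $\gamma(s)=(\cos s,0,\dots,0,\sin s,h(s))$. Primes denote $d/ds$. The unit normal field used is $\xi=\frac{1}{\sqrt{1+h'^2}}(-h'\sin s,\varphi_1h'\cos s,\dots,\varphi_mh'\cos s,-1)$, and $\alpha=\alpha(s)$ is the angle function defined by $\cos\alpha=\langle\xi,\partial_t\rangle=-\frac{1}{\sqrt{1+h'^2}}$ and $\sin\alpha=\frac{h'}{\sqrt{1+h'^2}}$, where $\partial_t$ is the unit vector field tangent to $\mathbb{R}$. The mean curvature is $H=\frac1m\operatorname{trace}A$ with $A$ the shape operator for $\xi$. A hypersurface is biharmonic if its defining isometric immersion is a biharmonic map (critical point of the bienergy $\frac12\int|\tau|^2$, $\tau$ the tension field). *)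

theory Defs
  imports "HOL-Analysis.Analysis"
begin

section \<open>Smooth maps and coordinate derivatives\<close>

text \<open>Only meant for open sets \<open>S\<close>.\<close>

primrec Ck_on :: "nat \<Rightarrow> 'a::real_normed_vector set \<Rightarrow> ('a \<Rightarrow> 'b::real_normed_vector) \<Rightarrow> bool" where
  "Ck_on 0 S f \<longleftrightarrow> continuous_on S f"
| "Ck_on (Suc k) S f \<longleftrightarrow>
     (\<forall>x\<in>S. f differentiable (at x)) \<and> (\<forall>w. Ck_on k S (\<lambda>x. frechet_derivative f (at x) w))"

definition smooth_on :: "'a::real_normed_vector set \<Rightarrow> ('a \<Rightarrow> 'b::real_normed_vector) \<Rightarrow> bool" where
  "smooth_on S f \<longleftrightarrow> (\<forall>k. Ck_on k S f)"

definition pd :: "'d::finite \<Rightarrow> (real^'d \<Rightarrow> 'b::real_normed_vector) \<Rightarrow> real^'d \<Rightarrow> 'b" where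
  "pd i F x = frechet_derivative F (at x) (axis i 1)"


section \<open>Riemannian metrics in coordinates\<close>

definition induced_metric :: "(real^'d::finite \<Rightarrow> 'b::real_inner) \<Rightarrow> real^'d \<Rightarrow> real^'d^'d" where
  "induced_metric f x = (\<chi> i j. pd i f x \<bullet> pd j f x)"

text \<open>\<open>christoffel g k i j\<close> is \<open>\<Gamma>\<close> with upper index \<open>k\<close> and lower indices \<open>i\<close>, \<open>j\<close>.\<close>

definition christoffel ::
  "(real^'d::finite \<Rightarrow> real^'d^'d) \<Rightarrow> 'd \<Rightarrow> 'd \<Rightarrow> 'd \<Rightarrow> real^'d \<Rightarrow> real" where
  "christoffel g k i j x =
     1/2 * (\<Sum>l\<in>UNIV. matrix_inv (g x) $ k $ l *
       (pd i (\<lambda>y. g y $ j $ l) x + pd j (\<lambda>y. g y $ i $ l) x - pd l (\<lambda>y. g y $ i $ j) x))"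


section \<open>Biharmonic maps into the product of a sphere and the real line\<close>

text \<open>
  The product of the unit sphere of a Euclidean space \<open>'e\<close> with the real line is regarded as a
  Riemannian submanifold of \<open>'e \<times> real\<close>. Its Levi-Civita connection is therefore the orthogonal
  projection of the derivative in \<open>'e \<times> real\<close> to the tangent space, and the tangent space
  at \<open>(q, t)\<close> consists of the \<open>(w, r)\<close> with \<open>w \<bullet> q = 0\<close>.
\<close>

definition sphere_line :: "('e::euclidean_space \<times> real) set" where
  "sphere_line = sphere 0 1 \<times> UNIV"

definition tangent_proj :: "'e::euclidean_space \<times> real \<Rightarrow> 'e \<times> real \<Rightarrow> 'e \<times> real" where
  "tangent_proj p w = (fst w - (fst w \<bullet> fst p) *\<^sub>R fst p, snd w)"

text \<open>The \<open>(i, j)\<close> coefficient of the second fundamental form \<open>\<nabla>dF\<close> of a map \<open>F\<close> from the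
  domain with metric \<open>g\<close> to \<open>sphere_line\<close>.\<close>

definition nabla_d ::
  "(real^'d::finite \<Rightarrow> real^'d^'d) \<Rightarrow> (real^'d \<Rightarrow> 'e::euclidean_space \<times> real)
     \<Rightarrow> 'd \<Rightarrow> 'd \<Rightarrow> real^'d \<Rightarrow> 'e \<times> real" where
  "nabla_d g F i j x =
     tangent_proj (F x) (pd i (pd j F) x) - (\<Sum>k\<in>UNIV. christoffel g k i j x *\<^sub>R pd k F x)"

definition tension ::
  "(real^'d::finite \<Rightarrow> real^'d^'d) \<Rightarrow> (real^'d \<Rightarrow> 'e::euclidean_space \<times> real)
     \<Rightarrow> real^'d \<Rightarrow> 'e \<times> real" where
  "tension g F x = (\<Sum>i\<in>UNIV. \<Sum>j\<in>UNIV. (matrix_inv (g x) $ i $ j) *\<^sub>R nabla_d g F i j x)"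

definition bienergy ::
  "(real^'d::finite \<Rightarrow> real^'d^'d) \<Rightarrow> (real^'d) set \<Rightarrow> (real^'d \<Rightarrow> 'e::euclidean_space \<times> real)
     \<Rightarrow> real" where
  "bienergy g K F = 1/2 * (LINT x:K|lborel. (norm (tension g F x))\<^sup>2 * sqrt (det (g x)))"

text \<open>Smooth variations of \<open>f\<close> through maps to \<open>sphere_line\<close> that fix \<open>f\<close> outside the compact
  set \<open>K\<close>.\<close>

definition compact_variation ::
  "(real^'d::finite) set \<Rightarrow> (real^'d \<Rightarrow> 'e::euclidean_space \<times> real) \<Rightarrow> (real^'d) set
     \<Rightarrow> (real \<Rightarrow> real^'d \<Rightarrow> 'e \<times> real) \<Rightarrow> bool" where
  "compact_variation U f K F \<longleftrightarrow>
     compact K \<and> K \<subseteq> U \<and> (\<forall>x\<in>U. F 0 x = f x) \<and>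
     (\<exists>\<epsilon>>0. smooth_on ({-\<epsilon><..<\<epsilon>} \<times> U) (\<lambda>(t, x). F t x) \<and>
            (\<forall>t\<in>{-\<epsilon><..<\<epsilon>}. (\<forall>x\<in>U. F t x \<in> sphere_line) \<and> (\<forall>x\<in>U - K. F t x = f x)))"

definition biharmonic_map ::
  "(real^'d::finite \<Rightarrow> real^'d^'d) \<Rightarrow> (real^'d) set \<Rightarrow> (real^'d \<Rightarrow> 'e::euclidean_space \<times> real)
     \<Rightarrow> bool" where
  "biharmonic_map g U f \<longleftrightarrow>
     smooth_on U f \<and> f ` U \<subseteq> sphere_line \<and>
     (\<forall>K F. compact_variation U f K F \<longrightarrow>
        ((\<lambda>t. bienergy g K (F t)) has_real_derivative 0) (at 0))"


section \<open>Hypersurfaces\<close>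

text \<open>With \<open>m = CARD('d)\<close>, the unit sphere of \<open>real \<times> (real^'d)\<close> is the \<open>m\<close>-dimensional sphere
  and the hypersurface has dimension \<open>m\<close>.\<close>

definition immersed_hypersurface ::
  "(real^'d::finite) set \<Rightarrow> (real^'d \<Rightarrow> (real \<times> (real^'d)) \<times> real) \<Rightarrow> bool" where
  "immersed_hypersurface U f \<longleftrightarrow>
     open U \<and> smooth_on U f \<and> f ` U \<subseteq> sphere_line \<and>
     (\<forall>x\<in>U. inj (frechet_derivative f (at x)))"

definition biharmonic_hypersurface ::
  "(real^'d::finite) set \<Rightarrow> (real^'d \<Rightarrow> (real \<times> (real^'d)) \<times> real) \<Rightarrow> bool" where
  "biharmonic_hypersurface U f \<longleftrightarrow>
     immersed_hypersurface U f \<and> biharmonic_map (induced_metric f) U f"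

text \<open>The matrix of the shape operator \<open>A\<close> for the unit normal field \<open>\<xi>\<close> in the coordinate
  frame; its sign is such that \<open>\<langle>A X, Y\<rangle> = \<langle>\<nabla>\<^sub>X Y, \<xi>\<rangle>\<close>, with \<open>\<nabla>\<close> the connection of
  \<open>sphere_line\<close>.\<close>

definition shape_operator ::
  "(real^'d::finite \<Rightarrow> (real \<times> (real^'d)) \<times> real) \<Rightarrow> (real^'d \<Rightarrow> (real \<times> (real^'d)) \<times> real)
     \<Rightarrow> real^'d \<Rightarrow> real^'d^'d" where
  "shape_operator f \<xi> x =
     matrix_inv (induced_metric f x) ** (\<chi> i j. tangent_proj (f x) (pd i (pd j f) x) \<bullet> \<xi> x)"

definition mean_curvature ::
  "(real^'d::finite \<Rightarrow> (real \<times> (real^'d)) \<times> real) \<Rightarrow> (real^'d \<Rightarrow> (real \<times> (real^'d)) \<times> real)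
     \<Rightarrow> real^'d \<Rightarrow> real" where
  "mean_curvature f \<xi> x = 1 / real CARD('d) * trace (shape_operator f \<xi> x)"


section \<open>Rotation hypersurfaces\<close>

text \<open>
  The index type \<open>'n\<close> numbers the coordinates \<open>v\<close> of the \<open>(m-1)\<close>-dimensional sphere, so
  \<open>m = CARD('n option) \<ge> 2\<close>. The components of \<open>\<phi>\<close> are numbered by \<open>'n option\<close>. A point
  of \<open>real^('n option)\<close> in the domain of the hypersurface has the coordinate \<open>s\<close> at index
  \<open>None\<close> and \<open>v\<close> at the indices \<open>Some i\<close>.
\<close>

definition orthogonal_sphere_param ::
  "(real^'n::finite) set \<Rightarrow> (real^'n \<Rightarrow> real^('n option)) \<Rightarrow> bool" where
  "orthogonal_sphere_param V \<phi> \<longleftrightarrow>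
     open V \<and> smooth_on V \<phi> \<and> (\<forall>v\<in>V. norm (\<phi> v) = 1) \<and>
     (\<forall>v\<in>V. \<forall>i. pd i \<phi> v \<noteq> 0) \<and>
     (\<forall>v\<in>V. \<forall>i j. i \<noteq> j \<longrightarrow> pd i \<phi> v \<bullet> pd j \<phi> v = 0)"

definition s_coord :: "real^('n::finite option) \<Rightarrow> real" where
  "s_coord x = x $ None"

definition v_coord :: "real^('n::finite option) \<Rightarrow> real^'n" where
  "v_coord x = (\<chi> i. x $ Some i)"

definition rotation_domain :: "real set \<Rightarrow> (real^'n::finite) set \<Rightarrow> (real^('n option)) set" where
  "rotation_domain I V = {x. s_coord x \<in> I \<and> v_coord x \<in> V}"

definition rotation_hypersurface ::
  "(real \<Rightarrow> real) \<Rightarrow> (real^'n::finite \<Rightarrow> real^('n option)) \<Rightarrow> real^('n option)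
     \<Rightarrow> (real \<times> (real^('n option))) \<times> real" where
  "rotation_hypersurface h \<phi> x =
     ((cos (s_coord x), sin (s_coord x) *\<^sub>R \<phi> (v_coord x)), h (s_coord x))"

definition rotation_normal ::
  "(real \<Rightarrow> real) \<Rightarrow> (real^'n::finite \<Rightarrow> real^('n option)) \<Rightarrow> real^('n option)
     \<Rightarrow> (real \<times> (real^('n option))) \<times> real" where
  "rotation_normal h \<phi> x =
     (let s = s_coord x; h' = deriv h s in
      (1 / sqrt (1 + h'\<^sup>2)) *\<^sub>R ((- h' * sin s, (h' * cos s) *\<^sub>R \<phi> (v_coord x)), - 1))"

definition angle_function :: "real set \<Rightarrow> (real^'n::finite) set \<Rightarrow> (real \<Rightarrow> real)
     \<Rightarrow> (real^'n \<Rightarrow> real^('n option)) \<Rightarrow> (real \<Rightarrow> real) \<Rightarrow> bool" where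
  "angle_function I V h \<phi> \<alpha> \<longleftrightarrow>
     (\<forall>x\<in>rotation_domain I V. cos (\<alpha> (s_coord x)) = rotation_normal h \<phi> x \<bullet> (0, 1)) \<and>
     (\<forall>s\<in>I. cos (\<alpha> s) = - 1 / sqrt (1 + (deriv h s)\<^sup>2) \<and>
             sin (\<alpha> s) = deriv h s / sqrt (1 + (deriv h s)\<^sup>2))"

end

theory Submission
  imports Defs
begin

text \<open>
  A hypersurface is biharmonic if its immersion is a critical point of the bienergy, so the
  proof has two parts: a first variation formula that turns this into a differential equation, and
  the observation that rotational symmetry reduces the equation to the two given ones.

  \<^bold>\<open>First variation.\<close> Orthogonality of the parametrization makes the induced metric diagonal, with
  entries \<open>E\<^sub>k\<close>. For a map \<open>F\<close> into the product of the sphere and the line, the tension field is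
  the tangential part of the coordinate Laplacian \<open>\<Delta>F\<close> taken in the ambient Euclidean space
  (\<open>tension_eq\<close>). Let \<open>T\<close> be the tension field of \<open>f\<close>, let \<open>p\<close> be the component of \<open>f\<close> in the
  sphere, and let \<open>W\<close> be the variation field, with spherical component \<open>W\<^sub>1\<close>. As \<open>T\<close> is tangent,
  only the following terms of the derivative of half the square of the tension field survive:
  \<open>T \<bullet> \<Delta>W - (\<Delta>p \<bullet> p) (T\<^sub>1 \<bullet> W\<^sub>1)\<close>. Green's identity moves the Laplacian to \<open>T\<close>. Hence \<open>f\<close> is
  biharmonic if the vector \<open>\<Delta>T - (\<Delta>p \<bullet> p) (T\<^sub>1, 0)\<close> has no tangential part
  (\<open>biharmonic_map_criterion\<close>). Green's identity is the divergence theorem for functions with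
  compact support, which here follows from the translation invariance of Lebesgue measure and
  differentiation under the integral sign.

  \<^bold>\<open>Reduction to the profile.\<close> Let \<open>n = m - 1\<close>. The parametrization satisfies \<open>\<Delta>\<phi> = - n \<phi>\<close>
  for the metric of the unit sphere, because \<open>\<phi>\<close> and its partial derivatives form an orthogonal
  basis. Therefore \<open>\<Delta>\<close> maps a field \<open>(a(s), b(s) \<phi>(v), c(s))\<close> to a field of the same shape
  (\<open>laplacian_field\<close>). With \<open>w = sqrt (1 - u\<^sup>2) = - cos \<alpha>\<close> and \<open>M = m H = u' + n u cot s\<close> one finds
  \<open>\<Delta>f = M \<xi> - (n + w\<^sup>2) (p, 0)\<close>, so \<open>T = M \<xi>\<close>, and the criterion becomes
  \<open>L (M w) = 0\<close> and \<open>L (M u) + n (1 - cot\<^sup>2 s) M u = 0\<close>, where \<open>L\<close> is the Laplacian on functions of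
  \<open>s\<close>. Rotating this pair of equations by the unit vector \<open>(u, w)\<close> gives exactly the two equations
  of the theorem, up to the factors \<open>m\<close> and \<open>w\<close> (\<open>profile_equations\<close>).
\<close>

section \<open>Smooth maps\<close>

lemma frechet_derivative_cong_open:
  assumes "open S" "x \<in> S" "\<And>y. y \<in> S \<Longrightarrow> f y = g y"
  shows "frechet_derivative f (at x) = frechet_derivative g (at x)"
proof -
  have "(f has_derivative D) (at x) \<longleftrightarrow> (g has_derivative D) (at x)" for D
    using has_derivative_transform_within_open[of f D x UNIV S g]
      has_derivative_transform_within_open[of g D x UNIV S f] assms by auto
  then show ?thesis by (simp add: frechet_derivative_def)
qed

lemma frechet_derivative_eqI:
  "(f has_derivative D) (at x) \<Longrightarrow> frechet_derivative f (at x) = D"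
  by (metis frechet_derivative_at)

lemma Ck_on_cong:
  assumes "open S" "\<And>x. x \<in> S \<Longrightarrow> f x = g x"
  shows "Ck_on k S f \<longleftrightarrow> Ck_on k S g"
  using assms(2)
proof (induction k arbitrary: f g)
  case 0
  then show ?case by (simp cong: continuous_on_cong)
next
  case (Suc k)
  have "f differentiable (at x) \<longleftrightarrow> g differentiable (at x)" if "x \<in> S" for x
    using has_derivative_transform_within_open[of f _ x UNIV S g]
      has_derivative_transform_within_open[of g _ x UNIV S f] Suc.prems that assms(1)
    unfolding differentiable_def by fastforce
  moreover have "Ck_on k S (\<lambda>x. frechet_derivative f (at x) w) \<longleftrightarrow>
      Ck_on k S (\<lambda>x. frechet_derivative g (at x) w)" for w
    by (rule Suc.IH) (use frechet_derivative_cong_open[OF assms(1) _ Suc.prems] in auto)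
  ultimately show ?case by simp
qed

text \<open>Smoothness is defined through \<^const>\<open>frechet_derivative\<close>; this rule lets one work with any
  explicit formula for the derivative, and is how all closure properties below are obtained.\<close>

lemma Ck_on_SucI:
  assumes "open S" "\<And>x. x \<in> S \<Longrightarrow> (f has_derivative f' x) (at x)"
    and "\<And>w. Ck_on k S (\<lambda>x. f' x w)"
  shows "Ck_on (Suc k) S f"
proof -
  have "Ck_on k S (\<lambda>x. frechet_derivative f (at x) w)" for w
    using assms(3)[of w] Ck_on_cong[OF assms(1), of "\<lambda>x. frechet_derivative f (at x) w"]
      frechet_derivative_eqI[OF assms(2)] by simp
  then show ?thesis using assms(2) by (auto simp: differentiable_def)
qed

lemma Ck_on_SucD: "Ck_on (Suc k) S f \<Longrightarrow> Ck_on k S f"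
proof (induction k arbitrary: f)
  case 0
  then show ?case
    by (auto intro!: continuous_at_imp_continuous_on differentiable_imp_continuous_within)
qed auto

lemma Ck_on_has_derivative:
  "Ck_on (Suc k) S f \<Longrightarrow> x \<in> S \<Longrightarrow> (f has_derivative frechet_derivative f (at x)) (at x)"
  by (simp add: frechet_derivative_works)

lemma Ck_on_const: "open S \<Longrightarrow> Ck_on k S (\<lambda>x. c)"
proof (induction k arbitrary: c)
  case (Suc k)
  then show ?case by (intro Ck_on_SucI[where f' = "\<lambda>_ _. 0"]) auto
qed auto

lemma Ck_on_linear_compose:
  assumes "open S" "bounded_linear L" "Ck_on k S f"
  shows "Ck_on k S (\<lambda>x. L (f x))"
  using assms(3)
proof (induction k arbitrary: f)
  case 0
  then show ?case
    using bounded_linear.continuous_on[OF assms(2)] by auto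
next
  case (Suc k)
  show ?case
    by (rule Ck_on_SucI[OF assms(1),
          where f' = "\<lambda>x w. L (frechet_derivative f (at x) w)"])
      (use Suc in \<open>auto intro!: bounded_linear.has_derivative[OF assms(2)] Ck_on_has_derivative\<close>)
qed

lemma Ck_on_add:
  assumes "open S" "Ck_on k S f" "Ck_on k S g"
  shows "Ck_on k S (\<lambda>x. f x + g x)"
  using assms(2,3)
proof (induction k arbitrary: f g)
  case 0
  then show ?case by (auto intro: continuous_intros)
next
  case (Suc k)
  show ?case
    by (rule Ck_on_SucI[OF assms(1), where f' = "\<lambda>x w. frechet_derivative f (at x) w +
            frechet_derivative g (at x) w"])
      (use Suc in \<open>auto intro!: derivative_intros Ck_on_has_derivative\<close>)
qed

lemma Ck_on_bilinear:
  assumes "open S" "bounded_bilinear B" "Ck_on k S f" "Ck_on k S g"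
  shows "Ck_on k S (\<lambda>x. B (f x) (g x))"
  using assms(3,4)
proof (induction k arbitrary: f g)
  case 0
  then show ?case using bounded_bilinear.continuous_on[OF assms(2)] by auto
next
  case (Suc k)
  then show ?case
    by (intro Ck_on_SucI[OF assms(1), where f' = "\<lambda>x w. B (f x) (frechet_derivative g (at x) w) +
            B (frechet_derivative f (at x) w) (g x)"]
        bounded_bilinear.FDERIV[OF assms(2)] Ck_on_has_derivative Ck_on_add assms(1) Suc.IH)
      (auto dest: Ck_on_SucD simp del: Ck_on.simps, auto)
qed

text \<open>Affine inner maps cover the restriction to slices of a product, and functions of some of the
  coordinates.\<close>

lemma Ck_on_compose_affine:
  assumes "open S" "open S'" "bounded_linear L" "\<And>x. x \<in> S' \<Longrightarrow> c + L x \<in> S" "Ck_on k S f"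
  shows "Ck_on k S' (\<lambda>x. f (c + L x))"
  using assms(5)
proof (induction k arbitrary: f)
  case 0
  then show ?case
    using assms(4) bounded_linear.continuous_on[OF assms(3) continuous_on_id]
    by (auto intro!: continuous_on_compose2[of S f S'] continuous_intros)
next
  case (Suc k)
  have D: "((\<lambda>x. c + L x) has_derivative L) (at x)" for x
    using bounded_linear_imp_has_derivative[OF assms(3)] by (auto intro!: derivative_eq_intros)
  show ?case
  proof (rule Ck_on_SucI[OF assms(2), where f' = "\<lambda>x w. frechet_derivative f (at (c + L x)) (L w)"])
    fix x assume "x \<in> S'"
    then show "((\<lambda>x. f (c + L x)) has_derivative (\<lambda>w. frechet_derivative f (at (c + L x)) (L w))) (at x)"
      using has_derivative_compose[OF D Ck_on_has_derivative[OF Suc.prems assms(4)]] by simp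
  next
    fix w
    show "Ck_on k S' (\<lambda>x. frechet_derivative f (at (c + L x)) (L w))"
      using Suc.IH[of "\<lambda>y. frechet_derivative f (at y) (L w)"] Suc.prems by auto
  qed
qed

text \<open>The derivative of \<open>1 / f\<close> is a product of \<open>f'\<close> and two copies of \<open>1 / f\<close> itself, so the
  induction hypothesis for \<open>1 / f\<close> gives the next order. The same scheme works for square roots,
  and for sine and cosine taken together.\<close>

lemma Ck_on_inverse:
  fixes f :: "'a::real_normed_vector \<Rightarrow> real"
  assumes "open S" "\<And>x. x \<in> S \<Longrightarrow> f x \<noteq> 0" "Ck_on k S f"
  shows "Ck_on k S (\<lambda>x. inverse (f x))"
  using assms(3)
proof (induction k)
  case 0
  then show ?case using assms(2) by (auto intro!: continuous_intros)
next
  case (Suc k)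
  have IH: "Ck_on k S (\<lambda>x. inverse (f x))" using Suc Ck_on_SucD by blast
  have "Ck_on k S (\<lambda>x. frechet_derivative f (at x) w)" for w using Suc.prems by simp
  then have "Ck_on k S (\<lambda>x. - (inverse (f x) * frechet_derivative f (at x) w * inverse (f x)))" for w
    by (intro Ck_on_linear_compose[OF assms(1) bounded_linear_minus[OF bounded_linear_ident]]
        Ck_on_bilinear[OF assms(1) bounded_bilinear_mult] IH)
  then show ?case
    by (intro Ck_on_SucI[OF assms(1),
          where f' = "\<lambda>x w. - (inverse (f x) * frechet_derivative f (at x) w * inverse (f x))"]
        Deriv.has_derivative_inverse Ck_on_has_derivative[OF Suc.prems])
      (use assms(2) in auto)
qed

lemma Ck_on_sqrt:
  fixes f :: "'a::real_normed_vector \<Rightarrow> real"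
  assumes "open S" "\<And>x. x \<in> S \<Longrightarrow> f x > 0" "Ck_on k S f"
  shows "Ck_on k S (\<lambda>x. sqrt (f x))"
  using assms(3)
proof (induction k)
  case 0
  then show ?case by (auto intro!: continuous_intros)
next
  case (Suc k)
  have IH: "Ck_on k S (\<lambda>x. sqrt (f x))" using Suc Ck_on_SucD by blast
  have D: "((\<lambda>x. sqrt (f x)) has_derivative
      (\<lambda>w. frechet_derivative f (at x) w * (inverse (sqrt (f x)) * (1/2)))) (at x)" if "x \<in> S" for x
    using assms(2)[OF that]
    by (auto intro!: derivative_eq_intros Ck_on_has_derivative[OF Suc.prems that]
        simp: field_simps)
  have "Ck_on k S (\<lambda>x. frechet_derivative f (at x) w)" for w using Suc.prems by simp
  then have "Ck_on k S (\<lambda>x. frechet_derivative f (at x) w * (inverse (sqrt (f x)) * (1/2)))" for w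
    using assms(2) by (intro Ck_on_bilinear[OF assms(1) bounded_bilinear_mult]
        Ck_on_inverse[OF assms(1)] IH Ck_on_const assms(1)) force+
  then show ?case
    by (intro Ck_on_SucI[OF assms(1) D])
qed

lemma Ck_on_sin_cos:
  fixes f :: "'a::real_normed_vector \<Rightarrow> real"
  assumes "open S" "Ck_on k S f"
  shows "Ck_on k S (\<lambda>x. sin (f x)) \<and> Ck_on k S (\<lambda>x. cos (f x))"
  using assms(2)
proof (induction k)
  case 0
  then show ?case by (auto intro!: continuous_intros)
next
  case (Suc k)
  have IH: "Ck_on k S (\<lambda>x. sin (f x))" "Ck_on k S (\<lambda>x. cos (f x))" using Suc Ck_on_SucD by blast+
  have f': "Ck_on k S (\<lambda>x. frechet_derivative f (at x) w)" for w using Suc.prems by simp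
  have "Ck_on (Suc k) S (\<lambda>x. sin (f x))"
    by (rule Ck_on_SucI[OF assms(1), where f' = "\<lambda>x w. cos (f x) * frechet_derivative f (at x) w"])
      (auto intro!: derivative_eq_intros Ck_on_has_derivative[OF Suc.prems]
        Ck_on_bilinear[OF assms(1) bounded_bilinear_mult] IH f')
  moreover have "Ck_on (Suc k) S (\<lambda>x. cos (f x))"
    by (rule Ck_on_SucI[OF assms(1), where f' = "\<lambda>x w. - (sin (f x) * frechet_derivative f (at x) w)"])
      (auto intro!: derivative_eq_intros Ck_on_has_derivative[OF Suc.prems]
        Ck_on_linear_compose[OF assms(1) bounded_linear_minus[OF bounded_linear_ident]]
        Ck_on_bilinear[OF assms(1) bounded_bilinear_mult] IH f')
  ultimately show ?case by blast
qed

named_theorems smooth_intros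

lemma smooth_on_const [smooth_intros]: "open S \<Longrightarrow> smooth_on S (\<lambda>x. c)"
  by (simp add: smooth_on_def Ck_on_const)

lemma smooth_on_cong:
  "open S \<Longrightarrow> (\<And>x. x \<in> S \<Longrightarrow> f x = g x) \<Longrightarrow> smooth_on S f \<longleftrightarrow> smooth_on S g"
  unfolding smooth_on_def using Ck_on_cong by blast

lemma smooth_on_linear_compose:
  "bounded_linear L \<Longrightarrow> open S \<Longrightarrow> smooth_on S f \<Longrightarrow> smooth_on S (\<lambda>x. L (f x))"
  by (simp add: smooth_on_def Ck_on_linear_compose)

lemma smooth_on_add [smooth_intros]:
  "open S \<Longrightarrow> smooth_on S f \<Longrightarrow> smooth_on S g \<Longrightarrow> smooth_on S (\<lambda>x. f x + g x)"
  by (simp add: smooth_on_def Ck_on_add)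

lemma smooth_on_bilinear:
  "bounded_bilinear B \<Longrightarrow> open S \<Longrightarrow> smooth_on S f \<Longrightarrow> smooth_on S g \<Longrightarrow> smooth_on S (\<lambda>x. B (f x) (g x))"
  by (simp add: smooth_on_def Ck_on_bilinear)

lemmas smooth_on_mult [smooth_intros] = smooth_on_bilinear[OF bounded_bilinear_mult]
lemmas smooth_on_scaleR [smooth_intros] = smooth_on_bilinear[OF bounded_bilinear_scaleR]
lemmas smooth_on_inner [smooth_intros] = smooth_on_bilinear[OF bounded_bilinear_inner]
lemmas smooth_on_minus [smooth_intros] =
  smooth_on_linear_compose[OF bounded_linear_minus[OF bounded_linear_ident]]
lemmas smooth_on_fst [smooth_intros] = smooth_on_linear_compose[OF bounded_linear_fst]
lemmas smooth_on_snd [smooth_intros] = smooth_on_linear_compose[OF bounded_linear_snd]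

lemma smooth_on_diff [smooth_intros]:
  "open S \<Longrightarrow> smooth_on S f \<Longrightarrow> smooth_on S g \<Longrightarrow> smooth_on S (\<lambda>x. f x - g x)"
  using smooth_on_add[of S f "\<lambda>x. - g x"] smooth_on_minus[of S g] by simp

lemma smooth_on_Pair [smooth_intros]:
  assumes "open S" "smooth_on S f" "smooth_on S g"
  shows "smooth_on S (\<lambda>x. (f x, g x))"
proof -
  have "smooth_on S (\<lambda>x. (f x, 0) + (0, g x))"
    by (intro smooth_on_add assms(1)
        smooth_on_linear_compose[where L = "\<lambda>y. (y, 0)"] smooth_on_linear_compose[where L = "\<lambda>y. (0, y)"]
        assms bounded_linear_Pair bounded_linear_ident bounded_linear_zero)
  then show ?thesis by simp
qed

lemma smooth_on_sum [smooth_intros]: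
  "open S \<Longrightarrow> (\<And>i. i \<in> A \<Longrightarrow> smooth_on S (f i)) \<Longrightarrow> smooth_on S (\<lambda>x. \<Sum>i\<in>A. f i x)"
  by (induction A rule: infinite_finite_induct) (auto intro!: smooth_intros)

lemma smooth_on_prod [smooth_intros]:
  fixes f :: "'i \<Rightarrow> 'a::real_normed_vector \<Rightarrow> real"
  shows "open S \<Longrightarrow> (\<And>i. i \<in> A \<Longrightarrow> smooth_on S (f i)) \<Longrightarrow> smooth_on S (\<lambda>x. \<Prod>i\<in>A. f i x)"
  by (induction A rule: infinite_finite_induct) (auto intro!: smooth_intros)

lemma smooth_on_inverse [smooth_intros]:
  fixes f :: "'a::real_normed_vector \<Rightarrow> real"
  shows "open S \<Longrightarrow> smooth_on S f \<Longrightarrow> (\<And>x. x \<in> S \<Longrightarrow> f x \<noteq> 0) \<Longrightarrow> smooth_on S (\<lambda>x. inverse (f x))"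
  by (simp add: smooth_on_def Ck_on_inverse)

lemma smooth_on_divide [smooth_intros]:
  fixes f g :: "'a::real_normed_vector \<Rightarrow> real"
  shows "open S \<Longrightarrow> smooth_on S f \<Longrightarrow> smooth_on S g \<Longrightarrow> (\<And>x. x \<in> S \<Longrightarrow> g x \<noteq> 0) \<Longrightarrow>
    smooth_on S (\<lambda>x. f x / g x)"
  by (simp add: divide_inverse smooth_intros)

lemma smooth_on_sqrt [smooth_intros]:
  fixes f :: "'a::real_normed_vector \<Rightarrow> real"
  shows "open S \<Longrightarrow> smooth_on S f \<Longrightarrow> (\<And>x. x \<in> S \<Longrightarrow> f x > 0) \<Longrightarrow> smooth_on S (\<lambda>x. sqrt (f x))"
  by (simp add: smooth_on_def Ck_on_sqrt)

lemma smooth_on_power [smooth_intros]: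
  fixes f :: "'a::real_normed_vector \<Rightarrow> real"
  shows "open S \<Longrightarrow> smooth_on S f \<Longrightarrow> smooth_on S (\<lambda>x. f x ^ n)"
  by (induction n) (auto intro!: smooth_intros)

lemma smooth_on_sin [smooth_intros]:
  fixes f :: "'a::real_normed_vector \<Rightarrow> real"
  shows "open S \<Longrightarrow> smooth_on S f \<Longrightarrow> smooth_on S (\<lambda>x. sin (f x))"
  by (simp add: smooth_on_def Ck_on_sin_cos)

lemma smooth_on_cos [smooth_intros]:
  fixes f :: "'a::real_normed_vector \<Rightarrow> real"
  shows "open S \<Longrightarrow> smooth_on S f \<Longrightarrow> smooth_on S (\<lambda>x. cos (f x))"
  by (simp add: smooth_on_def Ck_on_sin_cos)

lemma smooth_on_compose_affine:
  "open S \<Longrightarrow> open S' \<Longrightarrow> bounded_linear L \<Longrightarrow> (\<And>x. x \<in> S' \<Longrightarrow> c + L x \<in> S) \<Longrightarrow> smooth_on S f \<Longrightarrow>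
    smooth_on S' (\<lambda>x. f (c + L x))"
  by (simp add: smooth_on_def Ck_on_compose_affine)

lemma smooth_on_ident [smooth_intros]:
  assumes "open S" shows "smooth_on S (\<lambda>x. x)"
  unfolding smooth_on_def
proof
  fix k show "Ck_on k S (\<lambda>x. x)"
    by (cases k) (auto intro!: Ck_on_SucI[where f' = "\<lambda>x w. w"] Ck_on_const assms simp del: Ck_on.simps(2))
qed

lemma smooth_on_has_derivative:
  "smooth_on S f \<Longrightarrow> x \<in> S \<Longrightarrow> (f has_derivative frechet_derivative f (at x)) (at x)"
  using Ck_on_has_derivative[of 0] unfolding smooth_on_def by blast

lemma smooth_on_frechet_derivative:
  "smooth_on S f \<Longrightarrow> smooth_on S (\<lambda>x. frechet_derivative f (at x) w)"
  unfolding smooth_on_def by (metis Ck_on.simps(2))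

lemma smooth_on_pd [smooth_intros]:
  "smooth_on S f \<Longrightarrow> smooth_on S (pd i f)"
  unfolding pd_def using smooth_on_frechet_derivative by blast

lemma smooth_on_deriv [smooth_intros]:
  fixes f :: "real \<Rightarrow> real"
  assumes "open S" "smooth_on S f" shows "smooth_on S (deriv f)"
proof -
  have "deriv f x = frechet_derivative f (at x) 1" if "x \<in> S" for x
    using smooth_on_has_derivative[OF assms(2) that]
    by (metis DERIV_imp_deriv has_field_derivative_def has_derivative_unique differentiableI
        differentiable_def frechet_derivative_at real_differentiableE mult.right_neutral)
  then show ?thesis
    using smooth_on_frechet_derivative[OF assms(2), of 1]
      smooth_on_cong[OF assms(1), of "deriv f"] by simp
qed

lemma smooth_on_continuous_on: "smooth_on S f \<Longrightarrow> continuous_on S f"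
  unfolding smooth_on_def by (metis Ck_on.simps(1))

lemma smooth_on_DERIV:
  fixes f :: "real \<Rightarrow> real"
  assumes "smooth_on S f" "x \<in> S"
  shows "(f has_real_derivative deriv f x) (at x)"
  using smooth_on_has_derivative[OF assms]
  by (metis differentiableI DERIV_deriv_iff_real_differentiable)

lemma deriv_cong_open:
  fixes a b :: "real \<Rightarrow> real"
  assumes "open I" "s \<in> I" "\<And>t. t \<in> I \<Longrightarrow> a t = b t"
  shows "deriv a s = deriv b s"
  by (rule deriv_cong_ev) (use eventually_nhds_in_open[OF assms(1,2)] assms(3) in \<open>auto elim: eventually_mono\<close>)

lemma deriv_mult:
  fixes a b :: "real \<Rightarrow> real"
  assumes "smooth_on I a" "smooth_on I b" "s \<in> I"
  shows "deriv (\<lambda>s. a s * b s) s = deriv a s * b s + a s * deriv b s"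
  using DERIV_mult[OF smooth_on_DERIV[OF assms(1,3)] smooth_on_DERIV[OF assms(2,3)]]
  by (intro DERIV_imp_deriv) (simp add: mult.commute)

lemma deriv2_mult:
  fixes a b :: "real \<Rightarrow> real"
  assumes open_I: "open I" and ab: "smooth_on I a" "smooth_on I b" "s \<in> I"
  shows "deriv (deriv (\<lambda>s. a s * b s)) s =
    deriv (deriv a) s * b s + 2 * (deriv a s * deriv b s) + a s * deriv (deriv b) s"
proof -
  note d = smooth_on_deriv[OF open_I ab(1)] smooth_on_deriv[OF open_I ab(2)]
  have "deriv (deriv (\<lambda>s. a s * b s)) s = deriv (\<lambda>s. deriv a s * b s + a s * deriv b s) s"
    by (rule deriv_cong_open[OF open_I ab(3)]) (rule deriv_mult[OF ab(1,2)])
  also have "\<dots> = deriv (\<lambda>s. deriv a s * b s) s + deriv (\<lambda>s. a s * deriv b s) s"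
    by (rule DERIV_imp_deriv)
      (intro DERIV_add smooth_on_DERIV[OF _ ab(3)] smooth_on_mult open_I d ab)
  also have "\<dots> = deriv (deriv a) s * b s + 2 * (deriv a s * deriv b s) + a s * deriv (deriv b) s"
    using deriv_mult[OF d(1) ab(2,3)] deriv_mult[OF ab(1) d(2) ab(3)] by simp
  finally show ?thesis .
qed


section \<open>Second derivatives and coordinate derivatives\<close>

lemma has_vector_derivative_along_line:
  assumes "(f has_derivative D) (at (x + t *\<^sub>R v))"
  shows "((\<lambda>t. f (x + t *\<^sub>R v)) has_vector_derivative D v) (at t)"
proof -
  have "((\<lambda>t. x + t *\<^sub>R v) has_derivative (\<lambda>h. h *\<^sub>R v)) (at t)"
    by (auto intro!: derivative_eq_intros)
  note c = has_derivative_compose[OF this assms]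
  show ?thesis
    unfolding has_vector_derivative_def
    by (rule has_derivative_eq_rhs[OF c])
      (simp add: fun_eq_iff linear_cmul[OF has_derivative_linear[OF assms]])
qed

text \<open>The left-hand side is symmetric in \<open>v\<close> and \<open>w\<close>, so this mean value statement, used in both
  orders and for small \<open>t\<close>, yields the symmetry of second derivatives.\<close>

lemma second_difference_mean_value:
  fixes F :: "'a::real_normed_vector \<Rightarrow> real"
  assumes F: "Ck_on (Suc (Suc 0)) S F" and t: "t > 0"
    and S: "\<And>a b. a \<in> {0..t} \<Longrightarrow> b \<in> {0..t} \<Longrightarrow> x + a *\<^sub>R v + b *\<^sub>R w \<in> S"
  shows "\<exists>a\<in>{0..t}. \<exists>b\<in>{0..t}.
    F (x + t *\<^sub>R v + t *\<^sub>R w) - F (x + t *\<^sub>R v) - F (x + t *\<^sub>R w) + F x =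
    t\<^sup>2 * frechet_derivative (\<lambda>y. frechet_derivative F (at y) v) (at (x + a *\<^sub>R v + b *\<^sub>R w)) w"
proof -
  let ?D = "\<lambda>y. frechet_derivative F (at y) v"
  have D1: "((\<lambda>a. F (x + a *\<^sub>R v + b *\<^sub>R w)) has_real_derivative ?D (x + a *\<^sub>R v + b *\<^sub>R w)) (at a)"
    if "a \<in> {0..t}" "b \<in> {0..t}" for a b
    using has_vector_derivative_along_line[of F _ "x + b *\<^sub>R w" a v]
      Ck_on_has_derivative[OF F S[OF that]]
    by (simp add: has_real_derivative_iff_has_vector_derivative algebra_simps)
  have D: "Ck_on (Suc 0) S ?D" using F by simp
  have D2: "((\<lambda>b. ?D (x + a *\<^sub>R v + b *\<^sub>R w)) has_real_derivative
      frechet_derivative ?D (at (x + a *\<^sub>R v + b *\<^sub>R w)) w) (at b)"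
    if "a \<in> {0..t}" "b \<in> {0..t}" for a b
    using has_vector_derivative_along_line[of ?D _ "x + a *\<^sub>R v" b w]
      Ck_on_has_derivative[OF D S[OF that]]
    by (simp add: has_real_derivative_iff_has_vector_derivative)
  have "\<exists>a. 0 < a \<and> a < t \<and>
      (F (x + t *\<^sub>R v + t *\<^sub>R w) - F (x + t *\<^sub>R v + 0 *\<^sub>R w)) -
      (F (x + 0 *\<^sub>R v + t *\<^sub>R w) - F (x + 0 *\<^sub>R v + 0 *\<^sub>R w)) =
      (t - 0) * (?D (x + a *\<^sub>R v + t *\<^sub>R w) - ?D (x + a *\<^sub>R v + 0 *\<^sub>R w))"
    by (rule MVT2[OF t]; use t in \<open>intro DERIV_diff D1; force\<close>)
  then obtain a where a: "0 < a" "a < t" and a_eq: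
    "F (x + t *\<^sub>R v + t *\<^sub>R w) - F (x + t *\<^sub>R v) - F (x + t *\<^sub>R w) + F x =
      t * (?D (x + a *\<^sub>R v + t *\<^sub>R w) - ?D (x + a *\<^sub>R v + 0 *\<^sub>R w))"
    by auto
  have "\<exists>b. 0 < b \<and> b < t \<and>
      ?D (x + a *\<^sub>R v + t *\<^sub>R w) - ?D (x + a *\<^sub>R v + 0 *\<^sub>R w) =
      (t - 0) * frechet_derivative ?D (at (x + a *\<^sub>R v + b *\<^sub>R w)) w"
    by (rule MVT2[OF t]; use t a in \<open>intro D2; force\<close>)
  then obtain b where b: "0 < b" "b < t" and b_eq:
    "?D (x + a *\<^sub>R v + t *\<^sub>R w) - ?D (x + a *\<^sub>R v + 0 *\<^sub>R w) =
      t * frechet_derivative ?D (at (x + a *\<^sub>R v + b *\<^sub>R w)) w"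
    by auto
  show ?thesis
    using a b a_eq unfolding b_eq
    by (intro bexI[of _ a] bexI[of _ b]) (auto simp: power2_eq_square)
qed

lemma frechet_derivative_commute_real:
  fixes F :: "'a::real_normed_vector \<Rightarrow> real"
  assumes "open S" "x \<in> S" and F: "Ck_on (Suc (Suc 0)) S F"
  shows "frechet_derivative (\<lambda>y. frechet_derivative F (at y) v) (at x) w =
    frechet_derivative (\<lambda>y. frechet_derivative F (at y) w) (at x) v"
proof -
  let ?P = "\<lambda>y. frechet_derivative (\<lambda>y. frechet_derivative F (at y) v) (at y) w"
  let ?Q = "\<lambda>y. frechet_derivative (\<lambda>y. frechet_derivative F (at y) w) (at y) v"
  have "\<bar>?P x - ?Q x\<bar> \<le> 0 + e" if "e > 0" for e
  proof -
    have "continuous_on S ?P" "continuous_on S ?Q"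
      using F by auto
    then have "isCont ?P x" "isCont ?Q x"
      using assms(1,2) by (auto simp: continuous_on_eq_continuous_at)
    then have "\<exists>d>0. \<forall>y. dist y x < d \<longrightarrow> dist (?P y) (?P x) < e/2"
      "\<exists>d>0. \<forall>y. dist y x < d \<longrightarrow> dist (?Q y) (?Q x) < e/2"
      using half_gt_zero[OF \<open>e > 0\<close>] unfolding continuous_at_eps_delta by blast+
    then obtain d1 d2 where d: "d1 > 0" "\<And>y. dist y x < d1 \<Longrightarrow> dist (?P y) (?P x) < e/2"
      "d2 > 0" "\<And>y. dist y x < d2 \<Longrightarrow> dist (?Q y) (?Q x) < e/2"
      by blast
    obtain d3 where d3: "d3 > 0" "\<And>y. dist y x < d3 \<Longrightarrow> y \<in> S"
      using assms(1,2) unfolding open_dist by blast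
    define r where "r = min d1 (min d2 d3)"
    define t where "t = r / (norm v + norm w + 1)"
    have n: "norm v + norm w + 1 > 0" by (smt (verit) norm_ge_zero)
    have r: "r > 0" using d d3 by (simp add: r_def)
    then have t: "t > 0" using n by (simp add: t_def)
    have near: "dist (x + a *\<^sub>R v + b *\<^sub>R w) x < r" if "a \<in> {0..t}" "b \<in> {0..t}" for a b
    proof -
      have "dist (x + a *\<^sub>R v + b *\<^sub>R w) x = norm (a *\<^sub>R v + b *\<^sub>R w)" by (simp add: dist_norm)
      also have "\<dots> \<le> norm (a *\<^sub>R v) + norm (b *\<^sub>R w)" by (rule norm_triangle_ineq)
      also have "\<dots> \<le> t * norm v + t * norm w"
        using that by (auto intro!: add_mono mult_right_mono)
      also have "\<dots> < t * (norm v + norm w + 1)" using t by (simp add: algebra_simps)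
      also have "\<dots> = r" using n by (simp add: t_def)
      finally show ?thesis .
    qed
    have S: "x + a *\<^sub>R v + b *\<^sub>R w \<in> S" if "a \<in> {0..t}" "b \<in> {0..t}" for a b
      using near[OF that] d3(2) by (simp add: r_def)
    have S': "x + a *\<^sub>R w + b *\<^sub>R v \<in> S" if "a \<in> {0..t}" "b \<in> {0..t}" for a b
      using S[OF that(2,1)] by (simp add: algebra_simps)
    obtain a b where ab: "a \<in> {0..t}" "b \<in> {0..t}"
      "F (x + t *\<^sub>R v + t *\<^sub>R w) - F (x + t *\<^sub>R v) - F (x + t *\<^sub>R w) + F x =
        t\<^sup>2 * ?P (x + a *\<^sub>R v + b *\<^sub>R w)"
      using second_difference_mean_value[OF F t S] by blast
    obtain a' b' where ab': "a' \<in> {0..t}" "b' \<in> {0..t}"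
      "F (x + t *\<^sub>R w + t *\<^sub>R v) - F (x + t *\<^sub>R w) - F (x + t *\<^sub>R v) + F x =
        t\<^sup>2 * ?Q (x + a' *\<^sub>R w + b' *\<^sub>R v)"
      using second_difference_mean_value[OF F t S'] by blast
    have "F (x + t *\<^sub>R w + t *\<^sub>R v) = F (x + t *\<^sub>R v + t *\<^sub>R w)"
      by (simp add: algebra_simps)
    then have "t\<^sup>2 * ?P (x + a *\<^sub>R v + b *\<^sub>R w) = t\<^sup>2 * ?Q (x + a' *\<^sub>R w + b' *\<^sub>R v)"
      using ab(3) ab'(3) by linarith
    then have "?P (x + a *\<^sub>R v + b *\<^sub>R w) = ?Q (x + a' *\<^sub>R w + b' *\<^sub>R v)" using t by simp
    moreover have "dist (?P (x + a *\<^sub>R v + b *\<^sub>R w)) (?P x) < e/2"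
      by (rule d(2)) (use near[OF ab(1,2)] in \<open>simp add: r_def\<close>)
    moreover have "dist (?Q (x + a' *\<^sub>R w + b' *\<^sub>R v)) (?Q x) < e/2"
      by (rule d(4)) (use near[OF ab'(2,1)] in \<open>simp add: r_def algebra_simps\<close>)
    ultimately show ?thesis unfolding dist_real_def by linarith
  qed
  then have "\<bar>?P x - ?Q x\<bar> \<le> 0" by (rule field_le_epsilon)
  then show ?thesis by simp
qed

text \<open>The real case carries over by taking inner products with all fixed vectors.\<close>

lemma frechet_derivative_commute:
  fixes F :: "'a::real_normed_vector \<Rightarrow> 'b::real_inner"
  assumes S: "open S" "x \<in> S" and F: "Ck_on (Suc (Suc 0)) S F"
  shows "frechet_derivative (\<lambda>y. frechet_derivative F (at y) v) (at x) w =
    frechet_derivative (\<lambda>y. frechet_derivative F (at y) w) (at x) v"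
proof -
  have 1: "frechet_derivative (\<lambda>y. F y \<bullet> b) (at y) v = frechet_derivative F (at y) v \<bullet> b"
    if "y \<in> S" for y v b
    using has_derivative_inner_left[OF Ck_on_has_derivative[OF F that], of b]
    by (simp add: frechet_derivative_eqI)
  have 2: "frechet_derivative (\<lambda>y. frechet_derivative F (at y) v \<bullet> b) (at x) w =
      frechet_derivative (\<lambda>y. frechet_derivative F (at y) v) (at x) w \<bullet> b" for v w b
  proof -
    have "Ck_on (Suc 0) S (\<lambda>y. frechet_derivative F (at y) v)"
      using F Ck_on.simps(2)[of "Suc 0"] by blast
    from has_derivative_inner_left[OF Ck_on_has_derivative[OF this S(2)], of b]
    show ?thesis by (simp add: frechet_derivative_eqI)
  qed
  have 3: "frechet_derivative (\<lambda>y. frechet_derivative (\<lambda>y. F y \<bullet> b) (at y) v) (at x) w =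
      frechet_derivative (\<lambda>y. frechet_derivative F (at y) v) (at x) w \<bullet> b" for v w b
    using frechet_derivative_cong_open[OF S 1[of _ b v]] 2 by simp
  have "Ck_on (Suc (Suc 0)) S (\<lambda>y. F y \<bullet> b)" for b
    by (rule Ck_on_linear_compose[OF S(1) bounded_linear_inner_left F])
  then show ?thesis
    using frechet_derivative_commute_real[OF S] 3 by (metis vector_eq_rdot)
qed

lemma pd_commute:
  fixes F :: "real^'d::finite \<Rightarrow> 'b::real_inner"
  assumes "open S" "x \<in> S" "smooth_on S F"
  shows "pd i (pd j F) x = pd j (pd i F) x"
  using frechet_derivative_commute[OF assms(1,2)] assms(3)
  unfolding smooth_on_def pd_def by blast


lemma pd_eqI: "(f has_derivative D) (at x) \<Longrightarrow> pd i f x = D (axis i 1)"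
  by (simp add: pd_def frechet_derivative_eqI)

lemma pd_cong:
  "open S \<Longrightarrow> x \<in> S \<Longrightarrow> (\<And>y. y \<in> S \<Longrightarrow> f y = g y) \<Longrightarrow> pd i f x = pd i g x"
  unfolding pd_def by (metis frechet_derivative_cong_open)

lemma pd_const [simp]: "pd i (\<lambda>x. c) x = 0"
  by (simp add: pd_def)

lemma pd_inner:
  assumes "smooth_on S f" "smooth_on S g" "x \<in> S"
  shows "pd i (\<lambda>y. f y \<bullet> g y) x = f x \<bullet> pd i g x + pd i f x \<bullet> g x"
  unfolding pd_def
  using has_derivative_inner[OF smooth_on_has_derivative[OF assms(1,3)] smooth_on_has_derivative[OF assms(2,3)]]
  by (simp add: frechet_derivative_eqI)

lemma unit_inner_pd:
  assumes "open S" "smooth_on S F" "\<And>y. y \<in> S \<Longrightarrow> F y \<bullet> F y = 1" "x \<in> S"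
  shows "F x \<bullet> pd i F x = 0"
proof -
  have "pd i (\<lambda>y. F y \<bullet> F y) x = 0"
    using pd_cong[OF assms(1,4,3), where i = i] by simp
  then show ?thesis using pd_inner[OF assms(2,2,4), of i] by (simp add: inner_commute)
qed

lemma pd_Pair:
  assumes "smooth_on S F" "smooth_on S G" "x \<in> S"
  shows "pd k (\<lambda>y. (F y, G y)) x = (pd k F x, pd k G x)"
  using has_derivative_Pair[OF smooth_on_has_derivative[OF assms(1,3)] smooth_on_has_derivative[OF assms(2,3)]]
  by (subst pd_eqI, assumption) (simp add: pd_def)

lemma pd_scaleR:
  assumes "smooth_on S F" "smooth_on S G" "x \<in> S"
  shows "pd k (\<lambda>y. F y *\<^sub>R G y) x = F x *\<^sub>R pd k G x + pd k F x *\<^sub>R G x"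
  using has_derivative_scaleR[OF smooth_on_has_derivative[OF assms(1,3)] smooth_on_has_derivative[OF assms(2,3)]]
  by (subst pd_eqI, assumption) (simp add: pd_def)

lemma has_vector_derivative_fst:
  assumes "smooth_on S G" "(t, x) \<in> S"
  shows "((\<lambda>t. G (t, x)) has_vector_derivative frechet_derivative G (at (t, x)) (1, 0)) (at t)"
  using has_vector_derivative_along_line[of G _ "(0, x)" t "(1, 0)"] smooth_on_has_derivative[OF assms]
  by simp

lemma pd_section:
  assumes "smooth_on S G" "(t, x) \<in> S"
  shows "pd i (\<lambda>x. G (t, x)) x = frechet_derivative G (at (t, x)) (0, axis i 1)"
proof -
  have "((\<lambda>x. (t, x)) has_derivative (\<lambda>h. (0, h))) (at x)"
    by (auto intro!: derivative_eq_intros)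
  from has_derivative_compose[OF this smooth_on_has_derivative[OF assms]]
  show ?thesis by (rule pd_eqI)
qed


section \<open>Differentiation under the integral and the divergence theorem\<close>

text \<open>On a smaller compact interval the \<open>t\<close>-derivative is bounded by continuity, so the difference
  quotients are dominated by a constant on \<open>K\<close>.\<close>

lemma leibniz_rule_compact:
  fixes h h' :: "real \<Rightarrow> 'a::euclidean_space \<Rightarrow> real"
  assumes K: "compact K" and \<delta>: "\<delta> > 0"
    and D: "\<And>t x. t \<in> {-\<delta><..<\<delta>} \<Longrightarrow> x \<in> K \<Longrightarrow> ((\<lambda>t. h t x) has_real_derivative h' t x) (at t)"
    and h: "\<And>t. t \<in> {-\<delta><..<\<delta>} \<Longrightarrow> continuous_on K (h t)"
    and h': "continuous_on ({-\<delta><..<\<delta>} \<times> K) (\<lambda>(t, x). h' t x)"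
  shows "((\<lambda>t. LINT x:K|lborel. h t x) has_real_derivative (LINT x:K|lborel. h' 0 x)) (at 0)"
proof -
  have KB: "K \<in> sets borel" using K by (rule borel_compact)
  have "compact ({-\<delta>/2..\<delta>/2} \<times> K)" using K by (simp add: compact_Times)
  moreover have "continuous_on ({-\<delta>/2..\<delta>/2} \<times> K) (\<lambda>(t, x). h' t x)"
    by (rule continuous_on_subset[OF h']) (use \<delta> in auto)
  ultimately have "bounded ((\<lambda>(t, x). h' t x) ` ({-\<delta>/2..\<delta>/2} \<times> K))"
    by (intro compact_imp_bounded compact_continuous_image)
  then obtain B where B: "\<bar>h' t x\<bar> \<le> B" if "t \<in> {-\<delta>/2..\<delta>/2}" "x \<in> K" for t x
    unfolding bounded_iff by fastforce
  have lip: "\<bar>h t x - h 0 x\<bar> \<le> B * \<bar>t\<bar>" if "t \<in> {-\<delta>/2..\<delta>/2}" "x \<in> K" for t x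
  proof -
    have "norm (h t x - h 0 x) \<le> B * norm (t - 0)"
      by (rule field_differentiable_bound[of "{-\<delta>/2..\<delta>/2}" _ "\<lambda>t. h' t x"])
        (use that \<delta> B in \<open>auto intro!: has_field_derivative_at_within[OF D]\<close>)
    then show ?thesis by simp
  qed
  have int: "set_integrable lborel K (h t)" if "t \<in> {-\<delta><..<\<delta>}" for t
    using borel_integrable_compact[OF K h[OF that]] by (simp add: set_integrable_def)
  show ?thesis
    unfolding has_field_derivative_iff tendsto_at_iff_sequentially
  proof (intro allI impI)
    fix X :: "nat \<Rightarrow> real" assume X: "\<forall>i. X i \<in> UNIV - {0}" "X \<longlonglongrightarrow> 0"
    then have "eventually (\<lambda>i. \<bar>X i\<bar> < \<delta>/2) sequentially"
      using \<delta> by (auto dest!: tendstoD[of _ _ _ "\<delta>/2"])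
    then obtain N where N: "\<bar>X i\<bar> < \<delta>/2" if "i \<ge> N" for i
      unfolding eventually_sequentially by blast
    define Y where "Y i = X (i + N)" for i
    have Y: "Y i \<noteq> 0" "\<bar>Y i\<bar> < \<delta>/2" for i using X N by (auto simp: Y_def)
    have Y0: "Y \<longlonglongrightarrow> 0" using LIMSEQ_ignore_initial_segment[OF X(2), of N] by (simp add: Y_def[abs_def])
    have Ym: "Y i \<in> {-\<delta>/2..\<delta>/2}" "Y i \<in> {-\<delta><..<\<delta>}" for i
      using Y(2)[of i] \<delta> by (auto simp: abs_less_iff)
    let ?s = "\<lambda>i x. indicator K x *\<^sub>R ((h (Y i) x - h 0 x) / Y i)"
    have "(\<lambda>i. LINT x|lborel. ?s i x) \<longlonglongrightarrow> (LINT x|lborel. indicator K x *\<^sub>R h' 0 x)"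
    proof (rule integral_dominated_convergence[where w = "\<lambda>x. indicator K x *\<^sub>R B"])
      have "continuous_on K (\<lambda>x. case (0, x) of (t, x) \<Rightarrow> h' t x)"
        by (rule continuous_on_compose2[OF h']) (use \<delta> in \<open>auto intro!: continuous_intros\<close>)
      then have "continuous_on K (h' 0)" by simp
      from borel_measurable_continuous_on_indicator[OF KB this]
      show "(\<lambda>x. indicator K x *\<^sub>R h' 0 x) \<in> borel_measurable lborel"
        by simp
      have "continuous_on K (\<lambda>x. (h (Y i) x - h 0 x) / Y i)" for i
        using \<delta> Ym[of i] Y(1)[of i] by (intro continuous_intros h) auto
      from borel_measurable_continuous_on_indicator[OF KB this]
      show "?s i \<in> borel_measurable lborel" for i
        by simp
      show "integrable lborel (\<lambda>x. indicator K x *\<^sub>R B)"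
        by (rule borel_integrable_compact[OF K]) auto
      show "AE x in lborel. (\<lambda>i. ?s i x) \<longlonglongrightarrow> indicator K x *\<^sub>R h' 0 x"
      proof (rule AE_I2)
        fix x
        show "(\<lambda>i. ?s i x) \<longlonglongrightarrow> indicator K x *\<^sub>R h' 0 x"
        proof (cases "x \<in> K")
          case True
          have "((\<lambda>t. (h t x - h 0 x) / (t - 0)) \<longlongrightarrow> h' 0 x) (at 0)"
            using D[of 0 x] True \<delta> unfolding has_field_derivative_iff by auto
          then have "(\<lambda>i. (h (Y i) x - h 0 x) / Y i) \<longlonglongrightarrow> h' 0 x"
            using Y0 Y(1) unfolding tendsto_at_iff_sequentially by (auto simp: comp_def)
          then show ?thesis using True by simp
        qed auto
      qed
      show "AE x in lborel. norm (?s i x) \<le> indicator K x *\<^sub>R B" for i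
        using lip[OF Ym(1)] Y(1)[of i] by (intro AE_I2) (auto simp: indicator_def divide_le_eq)
    qed
    moreover have "(LINT x|lborel. ?s i x) =
        ((LINT x:K|lborel. h (Y i) x) - (LINT x:K|lborel. h 0 x)) / (Y i - 0)" for i
      using set_integral_diff(2)[OF int[OF Ym(2)[of i]] int[of 0]] \<delta>
      by (simp add: set_lebesgue_integral_def)
    ultimately have "(\<lambda>i. ((LINT x:K|lborel. h (Y i) x) - (LINT x:K|lborel. h 0 x)) / (Y i - 0))
        \<longlonglongrightarrow> (LINT x:K|lborel. h' 0 x)"
      unfolding set_lebesgue_integral_def by (simp only:)
    then show "((\<lambda>t. ((LINT x:K|lborel. h t x) - (LINT x:K|lborel. h 0 x)) / (t - 0)) \<circ> X)
        \<longlonglongrightarrow> (LINT x:K|lborel. h' 0 x)"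
      unfolding Y_def comp_def by (rule LIMSEQ_offset)
  qed
qed

lemma integral_lborel_translate:
  fixes f :: "'a::euclidean_space \<Rightarrow> real"
  assumes "f \<in> borel_measurable borel"
  shows "(LINT x|lborel. f (x + c)) = (LINT x|lborel. f x)"
proof -
  have "(LINT x|lborel. f x) = (LINT x|distr lborel borel ((+) c). f x)"
    by (simp add: lborel_distr_plus)
  also have "\<dots> = (LINT x|lborel. f (c + x))"
    by (rule integral_distr) (use assms in auto)
  finally show ?thesis by (simp add: add.commute)
qed

text \<open>The divergence theorem for one component: extended by zero, \<open>G\<close> has the same integral as each of
  its translates along \<open>e\<close>, and the derivative of this constant in the translation parameter is
  the integral of the derivative of \<open>G\<close> along \<open>e\<close>.\<close>

lemma integral_derivative_compact_support:
  fixes G :: "'a::euclidean_space \<Rightarrow> real"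
  assumes U: "open U" and K: "compact K" "K \<subseteq> U" and G: "smooth_on U G"
    and supp: "\<And>x. x \<in> U - K \<Longrightarrow> G x = 0"
  shows "(LINT x:K|lborel. frechet_derivative G (at x) e) = 0"
proof -
  define G0 where "G0 x = (if x \<in> U then G x else 0)" for x
  define g where "g x = (if x \<in> K then frechet_derivative G (at x) e else 0)" for x
  have oK: "open (- K)" using K(1) compact_imp_closed by blast
  have "frechet_derivative G (at x) e = 0" if "x \<in> U - K" for x
    using frechet_derivative_cong_open[of "U - K" x G "\<lambda>x. 0"] that supp U K(1)
    by (simp add: open_Diff compact_imp_closed)
  then have g_U: "g x = frechet_derivative G (at x) e" if "x \<in> U" for x
    using that by (auto simp: g_def)
  have "continuous_on U g"
    using smooth_on_continuous_on[OF smooth_on_frechet_derivative[OF G, of e]] g_U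
    by (simp cong: continuous_on_cong)
  moreover have "continuous_on (- K) g" 
    using continuous_on_cong[of "- K" "- K" g "\<lambda>x. 0"] by (simp add: g_def)
  moreover have UK: "U \<union> - K = UNIV" using K by auto
  ultimately have g_cont: "continuous_on UNIV g"
    using continuous_on_open_Un[OF U oK] by metis
  \<comment> \<open>The zero extension is differentiable everywhere, since \<open>U\<close> and the complement of \<open>K\<close> form an open cover.\<close>
  have dir: "((\<lambda>t. G0 (x + t *\<^sub>R e)) has_real_derivative g (x + t *\<^sub>R e)) (at t)" for x t
  proof -
    let ?y = "x + t *\<^sub>R e"
    show ?thesis
    proof (cases "?y \<in> U")
      case True
      have "(G0 has_derivative frechet_derivative G (at ?y)) (at ?y)"
        by (rule has_derivative_transform_within_open[OF smooth_on_has_derivative[OF G True] U True])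
          (simp add: G0_def)
      then show ?thesis
        using has_vector_derivative_along_line g_U[OF True]
        by (metis has_real_derivative_iff_has_vector_derivative)
    next
      case False
      then have y: "?y \<in> - K" using K by auto
      have "(G0 has_derivative (\<lambda>_. 0)) (at ?y)"
        by (rule has_derivative_transform_within_open[OF has_derivative_const oK y])
          (use supp in \<open>auto simp: G0_def\<close>)
      then show ?thesis
        using has_vector_derivative_along_line[of G0 "\<lambda>_. 0" x t e] y
        by (simp add: has_real_derivative_iff_has_vector_derivative g_def)
    qed
  qed
  have "continuous_on U G0"
    using smooth_on_continuous_on[OF G] by (simp add: G0_def cong: continuous_on_cong)
  moreover have "continuous_on (- K) G0"
    using supp continuous_on_cong[of "- K" "- K" G0 "\<lambda>x. 0"] by (simp add: G0_def)
  ultimately have G0_cont: "continuous_on UNIV G0"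
    using continuous_on_open_Un[OF U oK] UK by metis
  obtain r where r: "\<And>x. x \<in> K \<Longrightarrow> norm x \<le> r"
    using compact_imp_bounded[OF K(1)] by (auto simp: bounded_iff)
  \<comment> \<open>Large enough to contain the support of every translate by \<open>t e\<close> with \<open>\<bar>t\<bar> < 1\<close>.\<close>
  define B where "B = cball (0::'a) (r + norm e)"
  have supp_B: "x \<in> B" if "x + t *\<^sub>R e \<in> K" "t \<in> {-1<..<1}" for x t
  proof -
    have "norm x \<le> norm (x + t *\<^sub>R e) + norm (t *\<^sub>R e)"
      using norm_triangle_ineq4[of "x + t *\<^sub>R e" "t *\<^sub>R e"] by simp
    also have "\<dots> \<le> r + 1 * norm e"
      using r[OF that(1)] that(2) mult_right_mono[of "\<bar>t\<bar>" 1 "norm e"]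
      by (simp add: abs_le_iff)
    finally show ?thesis by (simp add: B_def)
  qed
  have "((\<lambda>t. LINT x:B|lborel. G0 (x + t *\<^sub>R e)) has_real_derivative
      (LINT x:B|lborel. g (x + 0 *\<^sub>R e))) (at 0)"
    by (rule leibniz_rule_compact[where \<delta> = 1])
      (auto simp: B_def split_beta intro!: dir continuous_intros
        continuous_on_compose2[OF G0_cont] continuous_on_compose2[OF g_cont])
  moreover have "(LINT x:B|lborel. G0 (x + t *\<^sub>R e)) = (LINT x|lborel. G0 x)"
    if t: "t \<in> {-1<..<1}" for t
  proof -
    have "indicator B x *\<^sub>R G0 (x + t *\<^sub>R e) = G0 (x + t *\<^sub>R e)" for x
      using supp_B[OF _ t, of x] supp by (auto simp: indicator_def G0_def)
    then have "(\<lambda>x. indicator B x *\<^sub>R G0 (x + t *\<^sub>R e)) = (\<lambda>x. G0 (x + t *\<^sub>R e))" by blast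
    then show ?thesis
      using integral_lborel_translate[of G0 "t *\<^sub>R e"] G0_cont
      by (simp add: set_lebesgue_integral_def borel_measurable_continuous_onI)
  qed
  then have "((\<lambda>t. LINT x:B|lborel. G0 (x + t *\<^sub>R e)) has_real_derivative 0) (at 0)"
    using has_field_derivative_transform_within_open[of "\<lambda>t. LINT x|lborel. G0 x" 0 0 "{-1<..<1}"
        "\<lambda>t. LINT x:B|lborel. G0 (x + t *\<^sub>R e)"] by simp
  ultimately have "(LINT x:B|lborel. g x) = 0"
    using DERIV_unique by fastforce
  moreover have "indicator B x *\<^sub>R g x = indicator K x *\<^sub>R frechet_derivative G (at x) e" for x
    using supp_B[of x 0] by (auto simp: g_def indicator_def)
  ultimately show ?thesis by (simp add: set_lebesgue_integral_def)
qed


section \<open>The Laplacian of a diagonal metric\<close>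

text \<open>The Laplace-Beltrami operator \<open>(1 / \<rho>) \<Sum>\<^sub>k \<partial>\<^sub>k (\<rho> / E\<^sub>k \<partial>\<^sub>k X)\<close> of the metric with diagonal entries
  \<open>E\<^sub>k\<close> and density \<open>\<rho> = sqrt (\<Prod>\<^sub>i E\<^sub>i)\<close>, applied to each component of \<open>X\<close>. In this expanded form
  the logarithmic derivative of \<open>\<rho> / E\<^sub>k\<close> is the only trace of the density.\<close>

definition diagonal_laplacian ::
  "('d \<Rightarrow> real^'d \<Rightarrow> real) \<Rightarrow> (real^'d::finite \<Rightarrow> 'b::real_normed_vector) \<Rightarrow> real^'d \<Rightarrow> 'b" where
  "diagonal_laplacian E X x = (\<Sum>k\<in>UNIV. (1 / E k x) *\<^sub>R
     (pd k (pd k X) x + ((\<Sum>i\<in>UNIV. pd k (E i) x / E i x) / 2 - pd k (E k) x / E k x) *\<^sub>R pd k X x))"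

lemma diagonal_laplacian_cong:
  assumes "open S" "x \<in> S" "\<And>y. y \<in> S \<Longrightarrow> X y = Y y"
  shows "diagonal_laplacian E X x = diagonal_laplacian E Y x"
proof -
  have 1: "pd k X y = pd k Y y" if "y \<in> S" for y k
    using pd_cong[OF assms(1) that assms(3)] .
  have "pd k (pd k X) x = pd k (pd k Y) x" for k
    using pd_cong[OF assms(1,2) 1] .
  then show ?thesis using 1 assms(2) by (simp add: diagonal_laplacian_def)
qed

lemma matrix_inv_eqI:
  fixes A B :: "real^'n::finite^'n"
  assumes "A ** B = mat 1" "B ** A = mat 1"
  shows "matrix_inv A = B"
proof -
  have "A ** matrix_inv A = mat 1 \<and> matrix_inv A ** A = mat 1"
    unfolding matrix_inv_def by (rule someI[of _ B]) (use assms in simp)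
  then show ?thesis
    by (metis assms(2) matrix_mul_assoc matrix_mul_lid matrix_mul_rid)
qed

lemma matrix_inv_diagonal:
  assumes "\<And>i. e i \<noteq> 0"
  shows "matrix_inv (\<chi> i j. if i = j then e i else 0 :: real^'n::finite^'n) =
    (\<chi> i j. if i = j then 1 / e i else 0)"
proof (rule matrix_inv_eqI)
  have 1: "(if i = k then e i else 0) * (if k = j then 1 / e k else 0) =
      (if k = i then (if i = j then 1 else 0) else 0)"
    "(if i = k then 1 / e i else 0) * (if k = j then e k else 0) =
      (if k = i then (if i = j then 1 else 0) else 0)" for i j k
    using assms by auto
  show "(\<chi> i j. if i = j then e i else 0) ** (\<chi> i j. if i = j then 1 / e i else 0) = (mat 1 :: real^'n^'n)"
    by (simp add: matrix_matrix_mult_def mat_def vec_eq_iff 1 del: mult_if_delta)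
  show "(\<chi> i j. if i = j then 1 / e i else 0) ** (\<chi> i j. if i = j then e i else 0) = (mat 1 :: real^'n^'n)"
    by (simp add: matrix_matrix_mult_def mat_def vec_eq_iff 1 del: mult_if_delta)
qed

lemma linear_tangent_proj: "linear (tangent_proj p)"
  by (rule linearI) (auto simp: tangent_proj_def algebra_simps inner_add_left)

locale diagonal_metric =
  fixes U :: "(real^'d::finite) set" and g :: "real^'d \<Rightarrow> real^'d^'d" and E :: "'d \<Rightarrow> real^'d \<Rightarrow> real"
  assumes open_U: "open U"
    and metric: "\<And>x i j. x \<in> U \<Longrightarrow> g x $ i $ j = (if i = j then E i x else 0)"
    and E_pos: "\<And>x i. x \<in> U \<Longrightarrow> E i x > 0"
    and E_smooth: "\<And>i. smooth_on U (E i)"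
begin

lemma E_nz: "x \<in> U \<Longrightarrow> E i x \<noteq> 0"
  using E_pos[of x i] by simp

lemma matrix_inv_metric:
  assumes "x \<in> U"
  shows "matrix_inv (g x) $ i $ j = (if i = j then 1 / E i x else 0)"
proof -
  have "g x = (\<chi> i j. if i = j then E i x else 0)"
    using metric[OF assms] by (simp add: vec_eq_iff)
  then show ?thesis
    using matrix_inv_diagonal[of "\<lambda>i. E i x"] E_nz[OF assms] by simp
qed

lemma det_metric: "x \<in> U \<Longrightarrow> det (g x) = (\<Prod>i\<in>UNIV. E i x)"
  using det_diagonal[of "g x"] metric[of x] by simp

lemma pd_metric:
  assumes "x \<in> U"
  shows "pd k (\<lambda>y. g y $ i $ j) x = (if i = j then pd k (E i) x else 0)"
  using pd_cong[OF open_U assms, of "\<lambda>y. g y $ i $ j" "\<lambda>y. if i = j then E i y else 0" k]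
  by (simp add: metric)

text \<open>The Laplacian contains the Christoffel symbols only through this trace, which for a diagonal metric
  is, up to the factor \<open>- 1 / E\<^sub>k\<close>, the logarithmic derivative of \<open>\<rho> / E\<^sub>k\<close>, with \<open>\<rho>\<close> the
  Riemannian density.\<close>

lemma christoffel_diagonal_trace:
  assumes "x \<in> U"
  shows "(\<Sum>i\<in>UNIV. christoffel g k i i x / E i x) =
    - (1 / E k x) * ((\<Sum>i\<in>UNIV. pd k (E i) x / E i x) / 2 - pd k (E k) x / E k x)"
proof -
  have delta: "(\<Sum>l\<in>UNIV. (if k = l then c else 0) * A l) = c * A k" for c and A :: "'d \<Rightarrow> real"
  proof -
    have "(if k = l then c else 0) * A l = (if k = l then c * A l else 0)" for l by simp
    then show ?thesis by simp
  qed
  have "christoffel g k i i x / E i x =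
      (if k = i then pd k (E k) x / E k x / E k x else 0) - 1 / (2 * E k x) * (pd k (E i) x / E i x)" for i
    unfolding christoffel_def pd_metric[OF assms] matrix_inv_metric[OF assms] delta
    using E_nz[OF assms, of i] E_nz[OF assms, of k] by (cases "k = i") (simp_all add: divide_simps)
  then have "(\<Sum>i\<in>UNIV. christoffel g k i i x / E i x) =
      pd k (E k) x / E k x / E k x - 1 / (2 * E k x) * (\<Sum>i\<in>UNIV. pd k (E i) x / E i x)"
    by (simp add: sum_subtractf sum_distrib_left)
  then show ?thesis
    by (simp add: algebra_simps)
qed

text \<open>The first order terms of the Laplacian are tangent already, because \<open>F\<close> stays in the
  manifold. Projecting the whole Laplacian is therefore the same as projecting the second
  derivatives only.\<close>

lemma tension_eq:
  fixes F :: "real^'d \<Rightarrow> 'e::euclidean_space \<times> real"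
  assumes F: "smooth_on U F" "F ` U \<subseteq> sphere_line" and x: "x \<in> U"
  shows "tension g F x = tangent_proj (F x) (diagonal_laplacian E F x)"
proof -
  let ?c = "\<lambda>k. (\<Sum>i\<in>UNIV. pd k (E i) x / E i x) / 2 - pd k (E k) x / E k x"
  have unit: "fst (F y) \<bullet> fst (F y) = 1" if "y \<in> U" for y
    using F(2) that by (auto simp: sphere_line_def norm_eq_1[symmetric])
  have "pd k (\<lambda>y. fst (F y)) x = fst (pd k F x)" for k
    using has_derivative_fst[OF smooth_on_has_derivative[OF F(1) x]] pd_eqI by (fastforce simp: pd_def)
  then have "fst (pd k F x) \<bullet> fst (F x) = 0" for k
    using unit_inner_pd[OF open_U smooth_on_fst[OF open_U F(1)] unit x, of k] by (simp add: inner_commute)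
  then have proj: "tangent_proj (F x) (pd k F x) = pd k F x" for k
    by (simp add: tangent_proj_def)
  note lin = linear_sum[OF linear_tangent_proj] linear_add[OF linear_tangent_proj]
    linear_cmul[OF linear_tangent_proj]
  have "tension g F x = (\<Sum>i\<in>UNIV. (1 / E i x) *\<^sub>R nabla_d g F i i x)"
    by (simp add: tension_def matrix_inv_metric[OF x] if_distrib[of "\<lambda>a. a *\<^sub>R _"] cong: if_cong)
  also have "\<dots> = (\<Sum>i\<in>UNIV. (1 / E i x) *\<^sub>R tangent_proj (F x) (pd i (pd i F) x)) -
      (\<Sum>i\<in>UNIV. \<Sum>k\<in>UNIV. (christoffel g k i i x / E i x) *\<^sub>R pd k F x)"
    by (simp add: nabla_d_def scaleR_diff_right sum_subtractf scaleR_sum_right)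
  also have "(\<Sum>i\<in>UNIV. \<Sum>k\<in>UNIV. (christoffel g k i i x / E i x) *\<^sub>R pd k F x) =
      (\<Sum>k\<in>UNIV. (\<Sum>i\<in>UNIV. christoffel g k i i x / E i x) *\<^sub>R pd k F x)"
    by (subst sum.swap) (simp add: scaleR_sum_left)
  also have "\<dots> = - (\<Sum>k\<in>UNIV. (1 / E k x) *\<^sub>R ?c k *\<^sub>R pd k F x)"
    unfolding christoffel_diagonal_trace[OF x] by (simp add: sum_negf)
  finally show ?thesis
    by (simp add: diagonal_laplacian_def lin proj scaleR_add_right sum.distrib)
qed

text \<open>The logarithmic derivative of \<open>\<rho> / E\<^sub>k\<close>; it is what makes \<^const>\<open>diagonal_laplacian\<close> a
  divergence.\<close>

lemma pd_density:
  assumes x: "x \<in> U"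
  shows "pd k (\<lambda>y. sqrt (\<Prod>i\<in>UNIV. E i y) / E k y) x =
    sqrt (\<Prod>i\<in>UNIV. E i x) / E k x *
      ((\<Sum>i\<in>UNIV. pd k (E i) x / E i x) / 2 - pd k (E k) x / E k x)"
proof -
  let ?P = "\<Prod>i\<in>UNIV. E i x"
  have P: "?P > 0" using E_pos[OF x] by (simp add: prod_pos)
  have D: "(E i has_derivative frechet_derivative (E i) (at x)) (at x)" for i
    using smooth_on_has_derivative[OF E_smooth x] .
  have prod: "(\<Prod>j\<in>UNIV - {i}. E j x) = ?P / E i x" for i
    using prod.remove[of UNIV i "\<lambda>j. E j x"] E_nz[OF x, of i] by simp
  have "((\<lambda>y. sqrt (\<Prod>i\<in>UNIV. E i y) / E k y) has_derivative
      (\<lambda>h. (\<Sum>i\<in>UNIV. frechet_derivative (E i) (at x) h * (?P / E i x)) * (inverse (sqrt ?P) / 2) / E k x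
        - sqrt ?P * frechet_derivative (E k) (at x) h / (E k x * E k x))) (at x)"
    using P E_nz[OF x, of k]
    by (auto intro!: derivative_eq_intros D simp: prod divide_simps mult_ac fun_eq_iff)
  then have "pd k (\<lambda>y. sqrt (\<Prod>i\<in>UNIV. E i y) / E k y) x =
      (\<Sum>i\<in>UNIV. pd k (E i) x * (?P / E i x)) * (inverse (sqrt ?P) / 2) / E k x
        - sqrt ?P * pd k (E k) x / (E k x * E k x)"
    by (subst pd_eqI) (auto simp: pd_def)
  also have "(\<Sum>i\<in>UNIV. pd k (E i) x * (?P / E i x)) = ?P * (\<Sum>i\<in>UNIV. pd k (E i) x / E i x)"
    by (simp add: sum_distrib_left mult_ac)
  also have "?P * (\<Sum>i\<in>UNIV. pd k (E i) x / E i x) * (inverse (sqrt ?P) / 2) =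
      (?P * inverse (sqrt ?P)) * ((\<Sum>i\<in>UNIV. pd k (E i) x / E i x) / 2)"
    by simp
  also have "?P * inverse (sqrt ?P) = sqrt ?P"
    using P by (simp add: real_div_sqrt flip: divide_inverse)
  finally show ?thesis
    by (simp add: algebra_simps)
qed

lemma smooth_density: "smooth_on U (\<lambda>y. sqrt (\<Prod>i\<in>UNIV. E i y))"
  by (intro smooth_intros open_U E_smooth prod_pos) (use E_pos in auto)

lemma smooth_diagonal_laplacian:
  fixes X :: "real^'d \<Rightarrow> 'b::real_normed_vector"
  assumes "smooth_on U X"
  shows "smooth_on U (diagonal_laplacian E X)"
  unfolding diagonal_laplacian_def[abs_def]
  by (intro smooth_intros open_U E_smooth assms) (use E_nz in auto)

text \<open>The integrand is the divergence of the field with components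
  \<open>(\<rho> / E\<^sub>k) (T \<bullet> \<partial>\<^sub>k X - \<partial>\<^sub>k T \<bullet> X)\<close>, which vanishes outside \<open>K\<close> together with \<open>X\<close>.\<close>

lemma green_identity:
  fixes T X :: "real^'d \<Rightarrow> 'b::real_inner"
  assumes K: "compact K" "K \<subseteq> U" and T: "smooth_on U T" and X: "smooth_on U X"
    and supp: "\<And>x. x \<in> U - K \<Longrightarrow> X x = 0"
  shows "(LINT x:K|lborel. (T x \<bullet> diagonal_laplacian E X x - diagonal_laplacian E T x \<bullet> X x) *
    sqrt (\<Prod>i\<in>UNIV. E i x)) = 0"
proof -
  let ?a = "\<lambda>k y. sqrt (\<Prod>i\<in>UNIV. E i y) / E k y"
  let ?w = "\<lambda>k y. T y \<bullet> pd k X y - pd k T y \<bullet> X y"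
  let ?G = "\<lambda>k y. ?a k y * ?w k y"
  have a: "smooth_on U (?a k)" for k
    by (intro smooth_intros smooth_density open_U E_smooth) (use E_nz in auto)
  have w: "smooth_on U (?w k)" for k by (intro smooth_intros open_U T X)
  have G: "smooth_on U (?G k)" for k by (intro smooth_on_mult open_U a w)
  have pd_w: "pd k (?w k) x = T x \<bullet> pd k (pd k X) x - pd k (pd k T) x \<bullet> X x" if x: "x \<in> U" for k x
  proof -
    have "(?w k has_derivative (\<lambda>h. (T x \<bullet> frechet_derivative (pd k X) (at x) h
        + frechet_derivative T (at x) h \<bullet> pd k X x)
        - (pd k T x \<bullet> frechet_derivative X (at x) h + frechet_derivative (pd k T) (at x) h \<bullet> X x))) (at x)"
      by (intro has_derivative_diff has_derivative_inner
          smooth_on_has_derivative[OF _ x] smooth_intros T X)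
    then show ?thesis by (subst pd_eqI, assumption) (simp add: pd_def)
  qed
  have pd_G: "pd k (?G k) x = ?a k x * pd k (?w k) x + pd k (?a k) x * ?w k x" if x: "x \<in> U" for k x
  proof -
    have "(?G k has_derivative (\<lambda>h. ?a k x * frechet_derivative (?w k) (at x) h
        + frechet_derivative (?a k) (at x) h * ?w k x)) (at x)"
      by (intro has_derivative_mult smooth_on_has_derivative[OF _ x] a w)
    then show ?thesis by (subst pd_eqI, assumption) (simp add: pd_def)
  qed
  have pointwise: "(T x \<bullet> diagonal_laplacian E X x - diagonal_laplacian E T x \<bullet> X x) *
      sqrt (\<Prod>i\<in>UNIV. E i x) = (\<Sum>k\<in>UNIV. pd k (?G k) x)" if x: "x \<in> U" for x
    unfolding pd_G[OF x] pd_w[OF x] pd_density[OF x] diagonal_laplacian_def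
      inner_sum_left inner_sum_right sum_subtractf[symmetric] sum_distrib_right
    by (intro sum.cong refl)
      (simp add: inner_add_left inner_add_right algebra_simps add_divide_distrib diff_divide_distrib)
  have int: "integrable lborel (\<lambda>x. indicator K x *\<^sub>R pd k (?G k) x)" for k
    by (rule borel_integrable_compact[OF K(1)])
      (rule continuous_on_subset[OF smooth_on_continuous_on[OF smooth_on_pd[OF G]] K(2)])
  have "(LINT x:K|lborel. (T x \<bullet> diagonal_laplacian E X x - diagonal_laplacian E T x \<bullet> X x) *
      sqrt (\<Prod>i\<in>UNIV. E i x)) = (LINT x:K|lborel. (\<Sum>k\<in>UNIV. pd k (?G k) x))"
    by (rule set_lebesgue_integral_cong) (use K pointwise in \<open>auto intro: borel_compact\<close>)
  also have "\<dots> = (\<Sum>k\<in>UNIV. LINT x:K|lborel. pd k (?G k) x)"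
    unfolding set_lebesgue_integral_def scaleR_sum_right
    by (rule Bochner_Integration.integral_sum) (rule int)
  also have "\<dots> = 0"
  proof (rule sum.neutral, rule ballI)
    fix k
    have "?G k x = 0" if x: "x \<in> U - K" for x
    proof -
      have "pd k X x = pd k (\<lambda>y. 0) x"
        by (rule pd_cong[of "U - K"]) (use x supp K(1) open_U in \<open>auto simp: open_Diff compact_imp_closed\<close>)
      then show ?thesis using supp x by simp
    qed
    then show "(LINT x:K|lborel. pd k (?G k) x) = 0"
      unfolding pd_def using integral_derivative_compact_support[OF open_U K G[of k]] unfolding pd_def by blast
  qed
  finally show ?thesis .
qed


section \<open>The first variation of the bienergy\<close>

text \<open>The vector in the hypothesis is, up to its normal part and the sign convention, the bitension
  field of \<open>f\<close>: the rough Laplacian of \<open>T\<close> plus a curvature term, both written in the ambient Euclidean space. The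
  \<open>t\<close>-derivative of the squared tension field at \<open>t = 0\<close> is computed with the Laplacian on the
  variation field \<open>W\<close> (this uses that the \<open>t\<close>-derivative commutes with the coordinate
  derivatives), the hypothesis replaces the curvature term, and Green's identity then cancels what
  is left.\<close>

lemma biharmonic_map_criterion:
  fixes f :: "real^'d \<Rightarrow> 'e::euclidean_space \<times> real"
  defines "T \<equiv> \<lambda>x. tangent_proj (f x) (diagonal_laplacian E f x)"
  assumes f: "smooth_on U f" "f ` U \<subseteq> sphere_line"
    and jacobi: "\<And>x. x \<in> U \<Longrightarrow> tangent_proj (f x)
      (diagonal_laplacian E T x - (fst (diagonal_laplacian E f x) \<bullet> fst (f x)) *\<^sub>R (fst (T x), 0)) = 0"
  shows "biharmonic_map g U f"
  unfolding biharmonic_map_def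
proof (intro conjI allI impI f)
  fix K F assume var: "compact_variation U f K F"
  then have K: "compact K" "K \<subseteq> U" and F0: "\<And>x. x \<in> U \<Longrightarrow> F 0 x = f x"
    by (auto simp: compact_variation_def)
  from var obtain \<epsilon> where \<epsilon>: "\<epsilon> > 0" and "smooth_on ({-\<epsilon><..<\<epsilon>} \<times> U) (\<lambda>(t, x). F t x)"
    and sph: "\<And>t x. t \<in> {-\<epsilon><..<\<epsilon>} \<Longrightarrow> x \<in> U \<Longrightarrow> F t x \<in> sphere_line"
    and fixed: "\<And>t x. t \<in> {-\<epsilon><..<\<epsilon>} \<Longrightarrow> x \<in> U - K \<Longrightarrow> F t x = f x"
    by (auto simp: compact_variation_def)
  define \<Omega> where "\<Omega> = {-\<epsilon><..<\<epsilon>} \<times> U"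
  define G where "G = (\<lambda>(t, x). F t x)"
  define Dx where "Dx i z = frechet_derivative G (at z) (0, axis i 1)" for i z
  define Dxx where "Dxx i z = frechet_derivative (Dx i) (at z) (0, axis i 1)" for i z
  define Dt where "Dt z = frechet_derivative G (at z) (1, 0)" for z
  define c where "c k x = (\<Sum>i\<in>UNIV. pd k (E i) x / E i x) / 2 - pd k (E k) x / E k x" for k x
  define L where "L z = (\<Sum>k\<in>UNIV. (1 / E k (snd z)) *\<^sub>R (Dxx k z + c k (snd z) *\<^sub>R Dx k z))" for z
  define W where "W x = Dt (0, x)" for x
  define \<tau> where "\<tau> z = tangent_proj (G z) (L z)" for z
  define \<rho> where "\<rho> x = sqrt (\<Prod>i\<in>UNIV. E i x)" for x
  define q where "q z = (\<tau> z \<bullet> \<tau> z) * \<rho> (snd z)" for z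
  have \<Omega>: "open \<Omega>" using open_U by (simp add: \<Omega>_def open_Times)
  have G: "smooth_on \<Omega> G" using \<open>smooth_on _ (\<lambda>(t, x). F t x)\<close> by (simp add: G_def \<Omega>_def)
  have Dx: "smooth_on \<Omega> (Dx i)" for i
    using smooth_on_frechet_derivative[OF G] by (simp add: Dx_def[abs_def])
  have Dxx: "smooth_on \<Omega> (Dxx i)" for i
    using smooth_on_frechet_derivative[OF Dx] by (simp add: Dxx_def[abs_def])
  have Dt: "smooth_on \<Omega> Dt"
    using smooth_on_frechet_derivative[OF G] by (simp add: Dt_def[abs_def])
  have lift: "smooth_on \<Omega> (\<lambda>z. a (snd z))" if "smooth_on U a" for a :: "real^'d \<Rightarrow> real"
    using smooth_on_compose_affine[OF open_U \<Omega> bounded_linear_snd, of 0 a] that by (auto simp: \<Omega>_def)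
  have c: "smooth_on U (c k)" for k
    unfolding c_def[abs_def] by (intro smooth_intros open_U E_smooth) (use E_nz in auto)
  have L: "smooth_on \<Omega> L"
    unfolding L_def[abs_def]
    by (intro smooth_intros \<Omega> Dx Dxx lift c E_smooth) (use E_nz in \<open>auto simp: \<Omega>_def\<close>)
  have \<tau>: "smooth_on \<Omega> \<tau>"
    unfolding \<tau>_def[abs_def] tangent_proj_def by (intro smooth_intros \<Omega> L G)
  have \<rho>: "smooth_on U \<rho>"
    unfolding \<rho>_def[abs_def] by (rule smooth_density)
  have q: "smooth_on \<Omega> q"
    unfolding q_def[abs_def] by (intro smooth_intros \<Omega> \<tau> lift \<rho>)
  have lap: "diagonal_laplacian E (F t) x = L (t, x)" if z: "(t, x) \<in> \<Omega>" for t x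
  proof -
    have 1: "pd k (F t) y = Dx k (t, y)" if "y \<in> U" for k y
      using pd_section[OF G, of t y k] z that by (simp add: Dx_def G_def \<Omega>_def)
    have "pd k (pd k (F t)) x = pd k (\<lambda>y. Dx k (t, y)) x" for k
      using pd_cong[OF open_U _ 1] z by (simp add: \<Omega>_def)
    also have "\<dots> k = Dxx k (t, x)" for k
      using pd_section[OF Dx z] by (simp add: Dxx_def)
    finally show ?thesis
      using 1 z by (simp add: diagonal_laplacian_def L_def c_def \<Omega>_def)
  qed
  have slice: "(0, x) \<in> \<Omega>" if "x \<in> U" for x using that \<epsilon> by (simp add: \<Omega>_def)
  have W: "smooth_on U W"
    using smooth_on_compose_affine[OF \<Omega> open_U bounded_linear_Pair[OF bounded_linear_zero bounded_linear_ident],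
        of "(0, 0)" Dt] slice Dt by (simp add: W_def[abs_def])
  have W_supp: "W x = 0" if x: "x \<in> U - K" for x
  proof -
    have "((\<lambda>t. G (t, x)) has_vector_derivative W x) (at 0)"
      using has_vector_derivative_fst[OF G slice] x by (simp add: W_def Dt_def)
    moreover have "((\<lambda>t. G (t, x)) has_vector_derivative 0) (at 0)"
      by (rule has_vector_derivative_transform_within_open[where S = "{-\<epsilon><..<\<epsilon>}", OF has_vector_derivative_const])
        (use \<epsilon> x fixed in \<open>auto simp: G_def\<close>)
    ultimately show ?thesis by (rule vector_derivative_unique_at)
  qed
  have L_dt: "((\<lambda>t. L (t, x)) has_vector_derivative diagonal_laplacian E W x) (at 0)" if x: "x \<in> U" for x
  proof -
    have C2: "Ck_on (Suc (Suc 0)) \<Omega> G" "\<And>k. Ck_on (Suc (Suc 0)) \<Omega> (Dx k)"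
      using G Dx unfolding smooth_on_def by blast+
    \<comment> \<open>Both coordinate derivatives are exchanged with the derivative in \<open>t\<close>, one at a time.\<close>
    have comm1: "frechet_derivative (Dx k) (at z) (1, 0) = frechet_derivative Dt (at z) (0, axis k 1)"
      if "z \<in> \<Omega>" for z k
      using frechet_derivative_commute[OF \<Omega> that C2(1)] by (simp add: Dx_def[abs_def] Dt_def[abs_def])
    have W1: "pd k W y = frechet_derivative (Dx k) (at (0, y)) (1, 0)" if "y \<in> U" for k y
      using pd_section[OF Dt slice[OF that]] comm1[OF slice[OF that]] by (simp add: W_def[abs_def])
    have "pd k (pd k W) x = pd k (\<lambda>y. frechet_derivative (Dx k) (at (0, y)) (1, 0)) x" for k
      using pd_cong[OF open_U x W1] .
    also have "\<dots> k = frechet_derivative (\<lambda>z. frechet_derivative (Dx k) (at z) (1, 0)) (at (0, x)) (0, axis k 1)" for k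
      by (rule pd_section[OF smooth_on_frechet_derivative[OF Dx] slice[OF x]])
    also have "\<dots> k = frechet_derivative (Dxx k) (at (0, x)) (1, 0)" for k
      using frechet_derivative_commute[OF \<Omega> slice[OF x] C2(2)] by (simp add: Dxx_def[abs_def])
    finally have W2: "pd k (pd k W) x = frechet_derivative (Dxx k) (at (0, x)) (1, 0)" for k .
    show ?thesis
      unfolding L_def diagonal_laplacian_def W1[OF x] W2 snd_conv c_def[symmetric]
      by (intro has_vector_derivative_sum has_vector_derivative_add
          bounded_linear.has_vector_derivative[OF bounded_linear_scaleR_right]
          has_vector_derivative_fst[OF _ slice[OF x]] Dx Dxx)
  qed
  have q_dt: "frechet_derivative q (at (0, x)) (1, 0) =
      2 * ((T x \<bullet> diagonal_laplacian E W x - diagonal_laplacian E T x \<bullet> W x) * \<rho> x)"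
    if x: "x \<in> U" for x
  proof -
    let ?p = "\<lambda>t. fst (G (t, x))"
    let ?L' = "diagonal_laplacian E W x"
    have p1: "norm (?p t) = 1" if "t \<in> {-\<epsilon><..<\<epsilon>}" for t
      using sph[OF that x] by (auto simp: G_def sphere_line_def)
    have G0: "G (0, x) = f x" by (simp add: G_def F0 x)
    have L0: "L (0, x) = diagonal_laplacian E f x"
      using lap[OF slice[OF x]] diagonal_laplacian_cong[OF open_U x F0] by simp
    have \<tau>0: "\<tau> (0, x) = T x" by (simp add: \<tau>_def T_def G0 L0)
    have pp: "fst (f x) \<bullet> fst (f x) = 1" using p1[of 0] \<epsilon> by (simp add: G0 norm_eq_1)
    have Tp: "fst (T x) \<bullet> fst (f x) = 0"
      by (simp add: T_def tangent_proj_def inner_diff_left pp)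
    have G_dt: "((\<lambda>t. G (t, x)) has_vector_derivative W x) (at 0)"
      using has_vector_derivative_fst[OF G slice[OF x]] by (simp add: W_def Dt_def)
    note p_dt = bounded_linear.has_vector_derivative[OF bounded_linear_fst G_dt]
    \<comment> \<open>The variation stays in the sphere, so the variation field is tangent.\<close>
    have Wp: "fst (W x) \<bullet> fst (f x) = 0"
    proof -
      have "((\<lambda>t. ?p t \<bullet> ?p t) has_vector_derivative (?p 0 \<bullet> fst (W x) + fst (W x) \<bullet> ?p 0)) (at 0)"
        by (rule bounded_bilinear.has_vector_derivative[OF bounded_bilinear_inner p_dt p_dt])
      moreover have "((\<lambda>t. ?p t \<bullet> ?p t) has_vector_derivative 0) (at 0)"
        by (rule has_vector_derivative_transform_within_open[where S = "{-\<epsilon><..<\<epsilon>}", OF has_vector_derivative_const])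
          (use \<epsilon> p1 in \<open>auto simp: norm_eq_1\<close>)
      ultimately have "?p 0 \<bullet> fst (W x) + fst (W x) \<bullet> ?p 0 = 0"
        by (rule vector_derivative_unique_at)
      then show ?thesis by (simp add: G0 inner_commute)
    qed
    note L_dt = L_dt[OF x]
    note Lf_dt = bounded_linear.has_vector_derivative[OF bounded_linear_fst L_dt]
    note Ls_dt = bounded_linear.has_vector_derivative[OF bounded_linear_snd L_dt]
    let ?\<tau>' = "(fst ?L' - ((fst (L (0, x)) \<bullet> ?p 0) *\<^sub>R fst (W x)
        + (fst (L (0, x)) \<bullet> fst (W x) + fst ?L' \<bullet> ?p 0) *\<^sub>R ?p 0), snd ?L')"
    have \<tau>_dt: "((\<lambda>t. \<tau> (t, x)) has_vector_derivative ?\<tau>') (at 0)"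
      unfolding \<tau>_def tangent_proj_def
      by (intro has_vector_derivative_Pair has_vector_derivative_diff Lf_dt Ls_dt
          bounded_bilinear.has_vector_derivative[OF bounded_bilinear_scaleR]
          bounded_bilinear.has_vector_derivative[OF bounded_bilinear_inner] p_dt)
    have "((\<lambda>t. q (t, x)) has_vector_derivative (T x \<bullet> ?\<tau>' + ?\<tau>' \<bullet> T x) * \<rho> x) (at 0)"
      using bounded_linear.has_vector_derivative[OF bounded_linear_mult_left
          bounded_bilinear.has_vector_derivative[OF bounded_bilinear_inner \<tau>_dt \<tau>_dt], of "\<rho> x"]
      by (simp add: q_def \<tau>0)
    then have "frechet_derivative q (at (0, x)) (1, 0) = (T x \<bullet> ?\<tau>' + ?\<tau>' \<bullet> T x) * \<rho> x"
      using has_vector_derivative_fst[OF q slice[OF x]] vector_derivative_unique_at by blast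
    \<comment> \<open>The terms in the direction of \<open>p\<close> drop out because \<open>T\<close> is tangent.\<close>
    also have "T x \<bullet> ?\<tau>' + ?\<tau>' \<bullet> T x = 2 * (T x \<bullet> ?L' - (fst (L (0, x)) \<bullet> fst (f x)) * (fst (T x) \<bullet> fst (W x)))"
      using Tp by (simp add: inner_prod_def G0 inner_diff_left inner_diff_right inner_add_left inner_add_right
          inner_commute algebra_simps)
    also have "(fst (L (0, x)) \<bullet> fst (f x)) * (fst (T x) \<bullet> fst (W x)) = diagonal_laplacian E T x \<bullet> W x"
    proof -
      let ?Y = "diagonal_laplacian E T x - (fst (diagonal_laplacian E f x) \<bullet> fst (f x)) *\<^sub>R (fst (T x), 0)"
      have "tangent_proj (f x) Y \<bullet> W x = Y \<bullet> W x" for Y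
        using Wp by (simp add: tangent_proj_def inner_prod_def inner_diff_left inner_commute[of "fst (f x)"])
      from this[of ?Y] have "?Y \<bullet> W x = 0" using jacobi[OF x] by simp
      then show ?thesis by (simp add: inner_diff_left L0 inner_prod_def)
    qed
    finally show ?thesis by simp
  qed
  have T: "smooth_on U T"
    unfolding T_def tangent_proj_def by (intro smooth_intros open_U f smooth_diagonal_laplacian)
  have "((\<lambda>t. LINT x:K|lborel. q (t, x)) has_real_derivative
      (LINT x:K|lborel. frechet_derivative q (at (0, x)) (1, 0))) (at 0)"
  proof (rule leibniz_rule_compact[OF K(1) \<epsilon>])
    show "((\<lambda>t. q (t, x)) has_real_derivative frechet_derivative q (at (t, x)) (1, 0)) (at t)"
      if "t \<in> {-\<epsilon><..<\<epsilon>}" "x \<in> K" for t x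
      using has_vector_derivative_fst[OF q, of t x] that K(2)
      by (auto simp: \<Omega>_def has_real_derivative_iff_has_vector_derivative)
    show "continuous_on K (\<lambda>x. q (t, x))" if "t \<in> {-\<epsilon><..<\<epsilon>}" for t
      by (rule continuous_on_compose2[OF smooth_on_continuous_on[OF q]])
        (use that K(2) in \<open>auto simp: \<Omega>_def intro!: continuous_intros\<close>)
    show "continuous_on ({-\<epsilon><..<\<epsilon>} \<times> K) (\<lambda>(t, x). frechet_derivative q (at (t, x)) (1, 0))"
      using continuous_on_subset[OF smooth_on_continuous_on[OF smooth_on_frechet_derivative[OF q, of "(1, 0)"]],
          of "{-\<epsilon><..<\<epsilon>} \<times> K"] K(2)
      by (auto simp: \<Omega>_def split_beta)
  qed
  also have "(LINT x:K|lborel. frechet_derivative q (at (0, x)) (1, 0)) =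
      (LINT x:K|lborel. 2 * ((T x \<bullet> diagonal_laplacian E W x - diagonal_laplacian E T x \<bullet> W x) * \<rho> x))"
    by (rule set_lebesgue_integral_cong) (use K q_dt in \<open>auto intro: borel_compact\<close>)
  also have "\<dots> = 0"
    using green_identity[OF K T W W_supp] by (simp add: \<rho>_def)
  finally have "((\<lambda>t. 1/2 * (LINT x:K|lborel. q (t, x))) has_real_derivative 1/2 * 0) (at 0)"
    by (rule DERIV_cmult)
  moreover have "1/2 * (LINT x:K|lborel. q (t, x)) = bienergy g K (F t)" if t: "t \<in> {-\<epsilon><..<\<epsilon>}" for t
  proof -
    have Ft: "smooth_on U (F t)"
      using smooth_on_compose_affine[OF \<Omega> open_U bounded_linear_Pair[OF bounded_linear_zero bounded_linear_ident],
          of "(t, 0)" G] G t by (simp add: \<Omega>_def G_def)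
    have "q (t, x) = (norm (tension g (F t) x))\<^sup>2 * sqrt (det (g x))" if "x \<in> K" for x
    proof -
      have x: "x \<in> U" using that K(2) by auto
      have "tension g (F t) x = tangent_proj (F t x) (diagonal_laplacian E (F t) x)"
        by (rule tension_eq[OF Ft _ x]) (use sph[OF t] in auto)
      also have "\<dots> = \<tau> (t, x)" using lap[of t x] t x by (simp add: \<tau>_def \<Omega>_def G_def)
      finally show ?thesis by (simp add: q_def \<rho>_def det_metric[OF x] power2_norm_eq_inner)
    qed
    then show ?thesis
      unfolding bienergy_def using K by (subst set_lebesgue_integral_cong) (auto intro: borel_compact)
  qed
  ultimately show "((\<lambda>t. bienergy g K (F t)) has_real_derivative 0) (at 0)"
    using has_field_derivative_transform_within_open[of "\<lambda>t. 1/2 * (LINT x:K|lborel. q (t, x))" 0 0 "{-\<epsilon><..<\<epsilon>}"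
        "\<lambda>t. bienergy g K (F t)"] \<epsilon> by simp
qed

end


section \<open>Orthogonal parametrizations of the sphere\<close>

text \<open>The vectors \<open>p\<close> and \<open>e k\<close> are as many as the dimension, and orthogonal, so they span the whole
  space.\<close>

lemma orthogonal_frame_eq_0:
  fixes z p :: "real^('n::finite option)" and e :: "'n \<Rightarrow> real^('n option)"
  assumes "p \<noteq> 0" "\<And>k. e k \<noteq> 0" "\<And>k. e k \<bullet> p = 0" "\<And>i j. i \<noteq> j \<Longrightarrow> e i \<bullet> e j = 0"
    and "z \<bullet> p = 0" "\<And>k. z \<bullet> e k = 0"
  shows "z = 0"
proof -
  let ?B = "insert p (range e)"
  have orth: "e i \<bullet> e j = 0 \<or> e i = e j" for i j using assms(4) by (cases "i = j") auto
  have inj: "inj e"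
    using assms(2,4) by (metis inj_def inner_eq_zero_iff)
  have "p \<notin> range e" using assms(1,3) by (metis imageE inner_eq_zero_iff)
  then have card: "card ?B = CARD('n option)"
    using inj by (simp add: card_image)
  have ind: "independent ?B"
  proof (rule pairwise_orthogonal_independent)
    show "pairwise orthogonal ?B"
      using assms(3) orth by (auto simp: pairwise_def orthogonal_def inner_commute)
    show "0 \<notin> ?B" using assms(1,2) by auto
  qed
  have "span ?B = UNIV"
    using card_ge_dim_independent[of ?B UNIV] ind card by (auto simp: dim_UNIV)
  then have "z \<in> span ?B" by simp
  then have "orthogonal z z"
    by (rule orthogonal_to_span) (use assms(5,6) in \<open>auto simp: orthogonal_def\<close>)
  then show ?thesis by (simp add: orthogonal_def)
qed

text \<open>The coordinate functions are spherical harmonics of degree one. The Laplacian of \<open>\<phi>\<close> is normal to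
  the sphere: its inner product with \<open>\<partial>\<^sub>j \<phi>\<close> vanishes since derivatives of the metric entries express
  all inner products \<open>\<partial>\<^sub>i \<partial>\<^sub>i \<phi> \<bullet> \<partial>\<^sub>j \<phi>\<close>, the off-diagonal ones by symmetry of second derivatives and
  orthogonality. Its normal component is \<open>- \<Sum>\<^sub>i |\<partial>\<^sub>i \<phi>|\<^sup>2 / |\<partial>\<^sub>i \<phi>|\<^sup>2\<close>.\<close>

lemma diagonal_laplacian_orthogonal_sphere_param:
  fixes \<phi> :: "real^'n::finite \<Rightarrow> real^('n option)"
  assumes param: "orthogonal_sphere_param V \<phi>" and v: "v \<in> V"
  shows "diagonal_laplacian (\<lambda>i v. pd i \<phi> v \<bullet> pd i \<phi> v) \<phi> v = - real CARD('n) *\<^sub>R \<phi> v"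
proof -
  define l where "l i v = pd i \<phi> v \<bullet> pd i \<phi> v" for i v
  have V: "open V" and \<phi>: "smooth_on V \<phi>"
    using param by (auto simp: orthogonal_sphere_param_def)
  have norm: "\<phi> y \<bullet> \<phi> y = 1" if "y \<in> V" for y
    using param that by (simp add: orthogonal_sphere_param_def norm_eq_1)
  have nz: "pd i \<phi> v \<noteq> 0" for i
    using param v by (simp add: orthogonal_sphere_param_def)
  have orth: "pd i \<phi> y \<bullet> pd j \<phi> y = 0" if "y \<in> V" "i \<noteq> j" for y i j
    using param that by (simp add: orthogonal_sphere_param_def)
  note d\<phi> = smooth_on_pd[OF \<phi>]
  have tan: "pd i \<phi> y \<bullet> \<phi> y = 0" if "y \<in> V" for i y
    using unit_inner_pd[OF V \<phi> norm that, of i] by (simp add: inner_commute)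
  have second: "pd i (pd i \<phi>) v \<bullet> \<phi> v = - l i v" for i
  proof -
    have "pd i (\<lambda>y. pd i \<phi> y \<bullet> \<phi> y) v = 0"
      using pd_cong[OF V v tan, where i = i] by simp
    then show ?thesis using pd_inner[OF d\<phi>[of i] \<phi> v, of i] by (simp add: l_def)
  qed
  have dl: "pd k (l i) v = 2 * (pd i \<phi> v \<bullet> pd k (pd i \<phi>) v)" for i k
    using pd_inner[OF d\<phi>[of i] d\<phi>[of i] v, of k]
    by (simp add: l_def[abs_def] inner_commute[of "pd k (pd i \<phi>) v"])
  have mixed: "pd i (pd i \<phi>) v \<bullet> pd k \<phi> v = (if i = k then 1 else - 1) * (pd k (l i) v / 2)" for i k
  proof (cases "i = k")
    case False
    have "pd i (\<lambda>y. pd i \<phi> y \<bullet> pd k \<phi> y) v = pd i (\<lambda>y. 0) v"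
      by (rule pd_cong[OF V v]) (rule orth[OF _ False])
    then show ?thesis
      using pd_inner[OF d\<phi>[of i] d\<phi>[of k] v, of i] pd_commute[OF V v \<phi>, of i k] False by (simp add: dl)
  qed (simp add: dl inner_commute[of "pd k (pd k \<phi>) v"])
  have l: "l k v \<noteq> 0" for k using nz by (simp add: l_def)
  let ?c = "\<lambda>k. (\<Sum>i\<in>UNIV. pd k (l i) v / l i v) / 2 - pd k (l k) v / l k v"
  let ?Y = "diagonal_laplacian l \<phi> v"
  have "?Y \<bullet> \<phi> v = (\<Sum>k\<in>UNIV. (1 / l k v) * (- l k v))"
    by (simp add: diagonal_laplacian_def inner_sum_left inner_add_left second tan[OF v] del: mult_minus_right)
  also have "\<dots> = - real CARD('n)" using l by simp
  finally have Y_radial: "?Y \<bullet> \<phi> v = - real CARD('n)" .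
  have Y_tan: "?Y \<bullet> pd j \<phi> v = 0" for j
  proof -
    have "?Y \<bullet> pd j \<phi> v = (\<Sum>k\<in>UNIV. (1 / l k v) * (pd k (pd k \<phi>) v \<bullet> pd j \<phi> v)) +
        (\<Sum>k\<in>UNIV. (1 / l k v) * (?c k * (pd k \<phi> v \<bullet> pd j \<phi> v)))"
      by (simp add: diagonal_laplacian_def inner_sum_left inner_add_left distrib_left sum.distrib)
    also have "(\<Sum>k\<in>UNIV. (1 / l k v) * (?c k * (pd k \<phi> v \<bullet> pd j \<phi> v))) =
        (\<Sum>k\<in>UNIV. if k = j then ?c j else 0)"
      by (rule sum.cong) (use l orth[OF v] in \<open>auto simp flip: l_def\<close>)
    also have "\<dots> = ?c j" by simp
    also have "(\<Sum>k\<in>UNIV. (1 / l k v) * (pd k (pd k \<phi>) v \<bullet> pd j \<phi> v)) =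
        (\<Sum>k\<in>UNIV. (if k = j then pd j (l j) v / l j v else 0) - pd j (l k) v / l k v / 2)"
      by (rule sum.cong) (auto simp: mixed)
    also have "\<dots> = - ?c j" by (simp add: sum_subtractf sum_divide_distrib)
    finally show ?thesis by simp
  qed
  have "?Y + real CARD('n) *\<^sub>R \<phi> v = 0"
    by (rule orthogonal_frame_eq_0[of "\<phi> v" "\<lambda>k. pd k \<phi> v"])
      (use nz tan[OF v] orth[OF v] Y_radial Y_tan norm[OF v] in
        \<open>auto simp: inner_add_left inner_add_right inner_commute\<close>)
  then show ?thesis
    unfolding l_def[abs_def] by (simp add: eq_neg_iff_add_eq_0)
qed


section \<open>Geometry of rotation hypersurfaces\<close>

lemma sum_option:
  fixes F :: "'n::finite option \<Rightarrow> 'a::comm_monoid_add"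
  shows "(\<Sum>k\<in>UNIV. F k) = F None + (\<Sum>i\<in>UNIV. F (Some i))"
  by (simp add: UNIV_option_conv sum.reindex)

lemma bounded_linear_s_coord: "bounded_linear s_coord"
  unfolding s_coord_def[abs_def] by (rule bounded_linear_vec_nth)

lemma bounded_linear_v_coord: "bounded_linear v_coord"
  unfolding linear_conv_bounded_linear[symmetric]
  by (rule linearI) (auto simp: v_coord_def vec_eq_iff)

lemma coord_axis [simp]:
  "s_coord (axis None 1) = 1" "s_coord (axis (Some i) 1) = 0"
  "v_coord (axis None 1) = 0" "v_coord (axis (Some i) 1) = axis i 1"
  by (auto simp: s_coord_def v_coord_def axis_def vec_eq_iff)

lemma deriv_trig [simp]: "deriv sin = (cos :: real \<Rightarrow> real)" "deriv cos = (\<lambda>s::real. - sin s)"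
  by (auto intro!: DERIV_imp_deriv derivative_eq_intros)

text \<open>Vector fields of this shape contain the hypersurface itself, its unit normal and its tension
  field, and are preserved by the Laplacian.\<close>

definition rotation_field ::
  "(real^'n::finite \<Rightarrow> real^('n option)) \<Rightarrow> (real \<Rightarrow> real) \<Rightarrow> (real \<Rightarrow> real) \<Rightarrow> (real \<Rightarrow> real)
     \<Rightarrow> real^('n option) \<Rightarrow> (real \<times> (real^('n option))) \<times> real" where
  "rotation_field \<phi> a b c x =
     ((a (s_coord x), b (s_coord x) *\<^sub>R \<phi> (v_coord x)), c (s_coord x))"

definition rotation_metric ::
  "(real \<Rightarrow> real) \<Rightarrow> (real^'n::finite \<Rightarrow> real^('n option)) \<Rightarrow> 'n option \<Rightarrow> real^('n option) \<Rightarrow> real" where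
  "rotation_metric h \<phi> k x = (case k of None \<Rightarrow> 1 + (deriv h (s_coord x))\<^sup>2
     | Some i \<Rightarrow> (sin (s_coord x))\<^sup>2 * (pd i \<phi> (v_coord x) \<bullet> pd i \<phi> (v_coord x)))"

text \<open>The components \<open>- cos \<alpha>\<close> and \<open>- sin \<alpha>\<close> of the unit normal of the profile curve, as functions of
  the slope \<open>h'\<close>, and hence smooth without reference to a choice of \<open>\<alpha>\<close>.\<close>

definition profile_w :: "(real \<Rightarrow> real) \<Rightarrow> real \<Rightarrow> real" where
  "profile_w h s = 1 / sqrt (1 + (deriv h s)\<^sup>2)"

definition profile_u :: "(real \<Rightarrow> real) \<Rightarrow> real \<Rightarrow> real" where
  "profile_u h s = - deriv h s / sqrt (1 + (deriv h s)\<^sup>2)"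

text \<open>The Laplace-Beltrami operator of the hypersurface on functions of \<open>s\<close>, with \<open>w\<^sup>2 = 1 / (1 + h'\<^sup>2)\<close>
  and \<open>n\<close> the dimension of the rotated sphere: the density is \<open>|sin s|\<^sup>n / w\<close>, up to a factor that
  depends on the other coordinates only.\<close>

definition radial_laplacian :: "real \<Rightarrow> (real \<Rightarrow> real) \<Rightarrow> (real \<Rightarrow> real) \<Rightarrow> real \<Rightarrow> real" where
  "radial_laplacian n w a s =
     (w s)\<^sup>2 * deriv (deriv a) s + (n * cot s * (w s)\<^sup>2 + w s * deriv w s) * deriv a s"

text \<open>All formulas below depend on the index type only through its cardinality, which is therefore
  a parameter of its own.\<close>

locale rotation =
  fixes I :: "real set" and V :: "(real^'n::finite) set" and h :: "real \<Rightarrow> real"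
    and \<phi> :: "real^'n \<Rightarrow> real^('n option)" and n :: real
  assumes n_def: "n = real CARD('n)" and open_I: "open I" and sin_nz: "\<And>s. s \<in> I \<Longrightarrow> sin s \<noteq> 0" and h: "smooth_on I h"
    and param: "orthogonal_sphere_param V \<phi>"
begin

abbreviation "D \<equiv> rotation_domain I V"
abbreviation "w \<equiv> profile_w h"
abbreviation "u \<equiv> profile_u h"
abbreviation "E \<equiv> rotation_metric h \<phi>"

lemma domainD: "x \<in> D \<Longrightarrow> s_coord x \<in> I" "x \<in> D \<Longrightarrow> v_coord x \<in> V"
  by (auto simp: rotation_domain_def)

lemma V: "open V" and \<phi>: "smooth_on V \<phi>"
  using param by (auto simp: orthogonal_sphere_param_def)

lemma \<phi>_unit: "v \<in> V \<Longrightarrow> \<phi> v \<bullet> \<phi> v = 1"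
  using param by (simp add: orthogonal_sphere_param_def norm_eq_1)

lemma \<phi>_orth: "v \<in> V \<Longrightarrow> i \<noteq> j \<Longrightarrow> pd i \<phi> v \<bullet> pd j \<phi> v = 0"
  using param by (simp add: orthogonal_sphere_param_def)

lemma pd_\<phi>_pos: "v \<in> V \<Longrightarrow> pd i \<phi> v \<bullet> pd i \<phi> v > 0"
  using param by (simp add: orthogonal_sphere_param_def)

lemma \<phi>_tangent: "v \<in> V \<Longrightarrow> \<phi> v \<bullet> pd i \<phi> v = 0"
  by (rule unit_inner_pd[OF V \<phi> \<phi>_unit])

lemma open_D: "open D"
proof -
  have "D = s_coord -` I \<inter> v_coord -` V" by (auto simp: rotation_domain_def)
  then show ?thesis
    by (simp add: open_Int open_vimage open_I V bounded_linear.continuous_on[OF bounded_linear_s_coord continuous_on_id]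
        bounded_linear.continuous_on[OF bounded_linear_v_coord continuous_on_id])
qed

lemma smooth_s: "smooth_on I a \<Longrightarrow> smooth_on D (\<lambda>x. a (s_coord x))"
  using smooth_on_compose_affine[OF open_I open_D bounded_linear_s_coord, of 0 a] domainD by auto

lemma smooth_v: "smooth_on V a \<Longrightarrow> smooth_on D (\<lambda>x. a (v_coord x))"
  using smooth_on_compose_affine[OF V open_D bounded_linear_v_coord, of 0 a] domainD by auto

lemma pd_s:
  fixes a :: "real \<Rightarrow> real"
  assumes a: "smooth_on I a" and x: "x \<in> D"
  shows "pd None (\<lambda>x. a (s_coord x)) x = deriv a (s_coord x)"
    and "pd (Some i) (\<lambda>x. a (s_coord x)) x = 0"
proof -
  have "((\<lambda>x. a (s_coord x)) has_derivative (\<lambda>h. deriv a (s_coord x) * s_coord h)) (at x)"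
    using has_derivative_compose[OF bounded_linear_imp_has_derivative[OF bounded_linear_s_coord]
        smooth_on_DERIV[OF a domainD(1)[OF x], unfolded has_field_derivative_def]] .
  then show "pd None (\<lambda>x. a (s_coord x)) x = deriv a (s_coord x)"
    and "pd (Some i) (\<lambda>x. a (s_coord x)) x = 0"
    by (simp_all add: pd_eqI)
qed

lemma pd_v:
  assumes a: "smooth_on V a" and x: "x \<in> D"
  shows "pd None (\<lambda>x. a (v_coord x)) x = 0"
    and "pd (Some i) (\<lambda>x. a (v_coord x)) x = pd i a (v_coord x)"
proof -
  note A = smooth_on_has_derivative[OF a domainD(2)[OF x]]
  have "((\<lambda>x. a (v_coord x)) has_derivative (\<lambda>h. frechet_derivative a (at (v_coord x)) (v_coord h))) (at x)"
    using has_derivative_compose[OF bounded_linear_imp_has_derivative[OF bounded_linear_v_coord] A] .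
  then show "pd None (\<lambda>x. a (v_coord x)) x = 0"
    and "pd (Some i) (\<lambda>x. a (v_coord x)) x = pd i a (v_coord x)"
    using linear_0[OF has_derivative_linear[OF A]] by (simp_all add: pd_eqI) (simp add: pd_def)
qed

lemma smooth_field:
  assumes "smooth_on I a" "smooth_on I b" "smooth_on I c"
  shows "smooth_on D (rotation_field \<phi> a b c)"
  unfolding rotation_field_def[abs_def]
  by (intro smooth_intros open_D smooth_s smooth_v assms \<phi>)

lemma pd_field:
  assumes "smooth_on I a" "smooth_on I b" "smooth_on I c" and x: "x \<in> D"
  shows "pd None (rotation_field \<phi> a b c) x = rotation_field \<phi> (deriv a) (deriv b) (deriv c) x"
    and "pd (Some i) (rotation_field \<phi> a b c) x = ((0, b (s_coord x) *\<^sub>R pd i \<phi> (v_coord x)), 0)"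
proof -
  note sm = smooth_s[OF assms(1)] smooth_s[OF assms(2)] smooth_s[OF assms(3)] smooth_v[OF \<phi>]
  have "pd k (rotation_field \<phi> a b c) x = ((pd k (\<lambda>x. a (s_coord x)) x,
      b (s_coord x) *\<^sub>R pd k (\<lambda>x. \<phi> (v_coord x)) x + pd k (\<lambda>x. b (s_coord x)) x *\<^sub>R \<phi> (v_coord x)),
      pd k (\<lambda>x. c (s_coord x)) x)" for k
    unfolding rotation_field_def[abs_def]
    by (simp add: pd_Pair[OF _ _ x] pd_scaleR[OF _ _ x] smooth_on_Pair smooth_on_scaleR open_D sm)
  then show "pd None (rotation_field \<phi> a b c) x = rotation_field \<phi> (deriv a) (deriv b) (deriv c) x"
    and "pd (Some i) (rotation_field \<phi> a b c) x = ((0, b (s_coord x) *\<^sub>R pd i \<phi> (v_coord x)), 0)"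
    using x by (simp_all add: pd_s pd_v assms \<phi> rotation_field_def)
qed

lemma pd2_field:
  assumes abc: "smooth_on I a" "smooth_on I b" "smooth_on I c" and x: "x \<in> D"
  shows "pd None (pd None (rotation_field \<phi> a b c)) x =
      rotation_field \<phi> (deriv (deriv a)) (deriv (deriv b)) (deriv (deriv c)) x"
    and "pd (Some i) (pd (Some i) (rotation_field \<phi> a b c)) x =
      ((0, b (s_coord x) *\<^sub>R pd i (pd i \<phi>) (v_coord x)), 0)"
proof -
  have "pd None (pd None (rotation_field \<phi> a b c)) x =
      pd None (rotation_field \<phi> (deriv a) (deriv b) (deriv c)) x"
    by (rule pd_cong[OF open_D x]) (rule pd_field(1)[OF abc])
  then show "pd None (pd None (rotation_field \<phi> a b c)) x =
      rotation_field \<phi> (deriv (deriv a)) (deriv (deriv b)) (deriv (deriv c)) x"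
    using pd_field(1)[OF _ _ _ x] smooth_on_deriv[OF open_I] abc by simp
  have sm: "smooth_on D (\<lambda>y. pd i \<phi> (v_coord y))" "smooth_on D (\<lambda>y. b (s_coord y))"
    by (intro smooth_s smooth_v[OF smooth_on_pd[OF \<phi>]] abc)+
  have "pd (Some i) (pd (Some i) (rotation_field \<phi> a b c)) x =
      pd (Some i) (\<lambda>y. ((0, b (s_coord y) *\<^sub>R pd i \<phi> (v_coord y)), 0)) x"
    by (rule pd_cong[OF open_D x]) (rule pd_field(2)[OF abc])
  also have "\<dots> = ((0, b (s_coord x) *\<^sub>R pd i (pd i \<phi>) (v_coord x)), 0)"
    using pd_s(2)[OF abc(2) x] pd_v(2)[OF smooth_on_pd[OF \<phi>] x]
    by (simp add: pd_Pair[OF _ _ x] pd_scaleR[OF _ _ x] smooth_on_Pair smooth_on_const smooth_on_scaleR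
        open_D sm zero_prod_def)
  finally show "pd (Some i) (pd (Some i) (rotation_field \<phi> a b c)) x =
      ((0, b (s_coord x) *\<^sub>R pd i (pd i \<phi>) (v_coord x)), 0)" .
qed

lemma hypersurface_field: "rotation_hypersurface h \<phi> = rotation_field \<phi> cos sin h"
  by (simp add: fun_eq_iff rotation_hypersurface_def rotation_field_def)

lemma smooth_trig: "smooth_on I cos" "smooth_on I sin"
  using smooth_on_cos[OF open_I smooth_on_ident[OF open_I]] smooth_on_sin[OF open_I smooth_on_ident[OF open_I]]
  by simp_all

lemma pd_hypersurface:
  assumes "x \<in> D"
  shows "pd None (rotation_hypersurface h \<phi>) x = rotation_field \<phi> (\<lambda>s. - sin s) cos (deriv h) x"
    and "pd (Some i) (rotation_hypersurface h \<phi>) x = ((0, sin (s_coord x) *\<^sub>R pd i \<phi> (v_coord x)), 0)"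
  using pd_field[OF smooth_trig h assms] by (simp_all add: hypersurface_field)

sublocale diagonal_metric D "induced_metric (rotation_hypersurface h \<phi>)" E
proof
  show "open D" by (rule open_D)
  fix x i assume x: "x \<in> D"
  note v = domainD(2)[OF x]
  have pos: "1 + (deriv h (s_coord x))\<^sup>2 > 0" by (simp add: add_pos_nonneg)
  show "E i x > 0"
    using pd_\<phi>_pos[OF v] sin_nz[OF domainD(1)[OF x]] pos
    by (auto simp: rotation_metric_def split: option.split)
  fix j
  show "induced_metric (rotation_hypersurface h \<phi>) x $ i $ j = (if i = j then E i x else 0)"
  proof (cases i; cases j)
    assume "i = None" "j = None"
    then show ?thesis
      using \<phi>_unit[OF v] sin_cos_squared_add[of "s_coord x"]
      by (simp add: induced_metric_def pd_hypersurface[OF x] rotation_field_def rotation_metric_def power2_eq_square)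
  qed (auto simp: induced_metric_def pd_hypersurface[OF x] rotation_field_def rotation_metric_def
        power2_eq_square \<phi>_tangent[OF v] \<phi>_tangent[OF v, unfolded inner_commute[of "\<phi> _"]] \<phi>_orth[OF v])
next
  fix k show "smooth_on D (E k)"
    unfolding rotation_metric_def[abs_def]
    by (cases k) (auto intro!: smooth_intros open_D smooth_s smooth_v \<phi> open_I V h)
qed

lemma immersed: "immersed_hypersurface D (rotation_hypersurface h \<phi>)"
  unfolding immersed_hypersurface_def
proof (intro conjI ballI)
  show f: "smooth_on D (rotation_hypersurface h \<phi>)"
    unfolding hypersurface_field by (intro smooth_field smooth_trig h)
  show "rotation_hypersurface h \<phi> ` D \<subseteq> sphere_line"
  proof
    fix y assume "y \<in> rotation_hypersurface h \<phi> ` D"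
    then obtain x where x: "x \<in> D" "y = rotation_hypersurface h \<phi> x" by auto
    have "fst y \<bullet> fst y = (cos (s_coord x))\<^sup>2 + (sin (s_coord x))\<^sup>2"
      using \<phi>_unit[OF domainD(2)[OF x(1)]]
      by (simp add: x(2) rotation_hypersurface_def power2_eq_square)
    then have "norm (fst y) = 1" by (simp add: norm_eq_1)
    then show "y \<in> sphere_line"
      by (cases y) (simp add: sphere_line_def)
  qed
  fix x assume x: "x \<in> D"
  let ?L = "frechet_derivative (rotation_hypersurface h \<phi>) (at x)"
  have lin: "linear ?L" using has_derivative_linear[OF smooth_on_has_derivative[OF f x]] .
  have "y = 0" if "?L y = 0" for y
  proof -
    have "y $ k = 0" for k
    proof -
      have y_eq: "y = (\<Sum>i\<in>UNIV. y $ i *\<^sub>R axis i 1)"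
        using basis_expansion[of y] by (simp add: scalar_mult_eq_scaleR)
      have "?L y = (\<Sum>i\<in>UNIV. y $ i *\<^sub>R pd i (rotation_hypersurface h \<phi>) x)"
        by (subst y_eq) (simp add: linear_sum[OF lin] linear_cmul[OF lin] pd_def)
      then have "0 = (\<Sum>i\<in>UNIV. y $ i *\<^sub>R pd i (rotation_hypersurface h \<phi>) x) \<bullet>
          pd k (rotation_hypersurface h \<phi>) x"
        using that by simp
      also have "\<dots> = (\<Sum>i\<in>UNIV. y $ i * (pd i (rotation_hypersurface h \<phi>) x \<bullet> pd k (rotation_hypersurface h \<phi>) x))"
        by (simp add: inner_sum_left)
      also have "\<dots> = (\<Sum>i\<in>UNIV. if i = k then y $ k * E k x else 0)"
        using metric[OF x] by (intro sum.cong) (auto simp: induced_metric_def)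
      finally show ?thesis using E_pos[OF x, of k] by simp
    qed
    then show ?thesis by (simp add: vec_eq_iff)
  qed
  then show "inj ?L" using linear_injective_0[OF lin] by blast
qed (rule open_D)

lemma smooth_w: "smooth_on I w" and smooth_u: "smooth_on I u"
  unfolding profile_w_def[abs_def] profile_u_def[abs_def]
  by (intro smooth_intros open_I h; simp add: add_pos_nonneg less_imp_neq[symmetric] pos_add_strict)+


section \<open>The profile equations\<close>

abbreviation "L \<equiv> radial_laplacian n w"

lemma radial_laplacian_minus:
  assumes "smooth_on I a" "s \<in> I"
  shows "L (\<lambda>s. - a s) s = - L a s"
proof -
  have 1: "deriv (\<lambda>s. - b s) t = - deriv b t" if "smooth_on I b" "t \<in> I" for b t
    by (rule DERIV_imp_deriv) (rule DERIV_minus[OF smooth_on_DERIV[OF that]])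
  have "deriv (deriv (\<lambda>s. - a s)) s = deriv (\<lambda>s. - deriv a s) s"
    by (rule deriv_cong_open[OF open_I assms(2)]) (rule 1[OF assms(1)])
  also have "\<dots> = - deriv (deriv a) s"
    using 1[OF smooth_on_deriv[OF open_I assms(1)] assms(2)] .
  finally show ?thesis
    using 1[OF assms] by (simp add: radial_laplacian_def algebra_simps)
qed

lemma w_pos: "w s > 0"
  by (simp add: profile_w_def add_pos_nonneg)

lemma u_eq: "u s = - deriv h s * w s"
  by (simp add: profile_u_def profile_w_def)

lemma w_square: "(w s)\<^sup>2 = 1 / (1 + (deriv h s)\<^sup>2)"
  by (simp add: profile_w_def power_divide)

lemma unit: "(u s)\<^sup>2 + (w s)\<^sup>2 = 1"
proof -
  have "(u s)\<^sup>2 + (w s)\<^sup>2 = (1 + (deriv h s)\<^sup>2) * (w s)\<^sup>2"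
    by (simp add: u_eq power_mult_distrib algebra_simps)
  also have "\<dots> = 1"
    unfolding w_square using add_pos_nonneg[of 1 "(deriv h s)\<^sup>2"] by simp
  finally show ?thesis .
qed

lemma w_deriv:
  assumes "s \<in> I"
  shows "w s * deriv w s = - deriv h s * deriv (deriv h) s * (w s)^4"
proof -
  have sq: "w s * sqrt (1 + (deriv h s)\<^sup>2) = 1"
    using add_pos_nonneg[of 1 "(deriv h s)\<^sup>2"] by (simp add: profile_w_def)
  have p: "1 + (deriv h s)\<^sup>2 > 0" by (simp add: add_pos_nonneg)
  have "((\<lambda>s. (w s)\<^sup>2) has_real_derivative 2 * (w s * deriv w s)) (at s)"
    using smooth_on_DERIV[OF smooth_w assms] by (auto intro!: derivative_eq_intros)
  moreover have "((\<lambda>s. (w s)\<^sup>2) has_real_derivative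
      - (2 * deriv h s * deriv (deriv h) s) / (1 + (deriv h s)\<^sup>2)\<^sup>2) (at s)"
    unfolding w_square using p smooth_on_DERIV[OF smooth_on_deriv[OF open_I h] assms]
    by (auto intro!: derivative_eq_intros simp: power2_eq_square field_simps)
  ultimately have "2 * (w s * deriv w s) = - (2 * deriv h s * deriv (deriv h) s) / (1 + (deriv h s)\<^sup>2)\<^sup>2"
    by (rule DERIV_unique)
  also have "\<dots> = - (2 * deriv h s * deriv (deriv h) s) * ((w s)\<^sup>2)\<^sup>2"
    by (simp add: w_square power_divide)
  finally show ?thesis by simp
qed

text \<open>The metric is a warped product, so the \<open>s\<close>-direction contributes \<^const>\<open>radial_laplacian\<close> and
  the sphere of radius \<open>sin s\<close> contributes its Laplacian of \<open>\<phi>\<close>, which is \<open>- n \<phi> / (sin s)\<^sup>2\<close>.\<close>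

lemma laplacian_field:
  assumes abc: "smooth_on I a" "smooth_on I b" "smooth_on I c" and x: "x \<in> D"
  shows "diagonal_laplacian E (rotation_field \<phi> a b c) x =
    rotation_field \<phi> (L a) (\<lambda>s. L b s - n * b s / (sin s)\<^sup>2) (L c) x"
proof -
  let ?s = "s_coord x" and ?v = "v_coord x"
  define l where "l i v = pd i \<phi> v \<bullet> pd i \<phi> v" for i v
  note s = domainD(1)[OF x] and v = domainD(2)[OF x]
  have sin: "sin ?s \<noteq> 0" using sin_nz[OF s] .
  have l_nz: "l i ?v \<noteq> 0" for i using pd_\<phi>_pos[OF v, of i] by (simp add: l_def)
  have l_smooth: "smooth_on V (l i)" for i
    unfolding l_def[abs_def] by (intro smooth_intros V \<phi>)
  have sq: "smooth_on I (\<lambda>s. (sin s)\<^sup>2)" by (intro smooth_on_power open_I smooth_trig)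
  have hq: "smooth_on I (\<lambda>s. 1 + (deriv h s)\<^sup>2)" by (intro smooth_intros open_I h)
  have EN: "E None = (\<lambda>x. 1 + (deriv h (s_coord x))\<^sup>2)"
    and ES: "E (Some i) = (\<lambda>x. (sin (s_coord x))\<^sup>2 * l i (v_coord x))" for i
    by (simp_all add: rotation_metric_def fun_eq_iff l_def)
  have pE: "pd k (E (Some i)) x = pd k (\<lambda>x. (sin (s_coord x))\<^sup>2) x * l i ?v
      + (sin ?s)\<^sup>2 * pd k (\<lambda>x. l i (v_coord x)) x" for k i
    using pd_scaleR[OF smooth_s[OF sq] smooth_v[OF l_smooth] x] by (simp add: ES)
  have d_sq: "deriv (\<lambda>s. (sin s)\<^sup>2) ?s = 2 * sin ?s * cos ?s"
    by (rule DERIV_imp_deriv) (auto intro!: derivative_eq_intros)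
  have d_hq: "deriv (\<lambda>s. 1 + (deriv h s)\<^sup>2) ?s = 2 * deriv h ?s * deriv (deriv h) ?s"
    by (rule DERIV_imp_deriv)
      (use smooth_on_DERIV[OF smooth_on_deriv[OF open_I h] s] in \<open>auto intro!: derivative_eq_intros\<close>)
  have NN: "pd None (E None) x / E None x = - 2 * (w ?s * deriv w ?s) / (w ?s)\<^sup>2"
  proof -
    have "pd None (E None) x / E None x = 2 * deriv h ?s * deriv (deriv h) ?s * (w ?s)\<^sup>2"
      unfolding EN w_square using pd_s(1)[OF hq x] d_hq by simp
    then show ?thesis
      using w_pos[of ?s] by (simp add: w_deriv[OF s] power2_eq_square power4_eq_xxxx)
  qed
  have NS: "pd None (E (Some i)) x / E (Some i) x = 2 * cot ?s" for i
    using sin l_nz[of i] pd_s(1)[OF sq x] pd_v(1)[OF l_smooth x] d_sq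
    by (simp add: pE) (simp add: ES cot_def power2_eq_square)
  have SN: "pd (Some j) (E None) x = 0" for j
    unfolding EN using pd_s(2)[OF hq x] .
  have SS: "pd (Some j) (E (Some i)) x / E (Some i) x = pd j (l i) ?v / l i ?v" for i j
    using sin l_nz[of i] pd_s(2)[OF sq x] pd_v(2)[OF l_smooth x]
    by (simp add: pE) (simp add: ES)
  let ?X = "rotation_field \<phi> a b c"
  let ?c = "\<lambda>k. (\<Sum>i\<in>UNIV. pd k (E i) x / E i x) / 2 - pd k (E k) x / E k x"
  let ?d = "\<lambda>j. (\<Sum>i\<in>UNIV. pd j (l i) ?v / l i ?v) / 2 - pd j (l j) ?v / l j ?v"
  have cN: "?c None = n * cot ?s + w ?s * deriv w ?s / (w ?s)\<^sup>2"
    unfolding sum_option NS NN by (simp add: n_def field_simps)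
  have cS: "?c (Some j) = ?d j" for j
    unfolding sum_option SS by (simp add: SN)
  have EN': "1 / E None x = (w ?s)\<^sup>2" by (simp add: EN w_square)
  have coeff: "(w ?s)\<^sup>2 * (A + ?c None * B) = (w ?s)\<^sup>2 * A + (n * cot ?s * (w ?s)\<^sup>2 + w ?s * deriv w ?s) * B"
    for A B :: real
    unfolding cN using w_pos[of ?s] by (simp add: field_simps power2_eq_square)
  have radial: "(1 / E None x) *\<^sub>R (pd None (pd None ?X) x + ?c None *\<^sub>R pd None ?X x) =
      rotation_field \<phi> (L a) (L b) (L c) x"
    unfolding EN' pd2_field(1)[OF abc x] pd_field(1)[OF abc x]
    by (simp add: rotation_field_def radial_laplacian_def coeff flip: scaleR_add_left)
  have "(\<Sum>j\<in>UNIV. (1 / E (Some j) x) *\<^sub>R (pd (Some j) (pd (Some j) ?X) x + ?c (Some j) *\<^sub>R pd (Some j) ?X x)) =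
      (\<Sum>j\<in>UNIV. ((0, (b ?s / (sin ?s)\<^sup>2) *\<^sub>R ((1 / l j ?v) *\<^sub>R (pd j (pd j \<phi>) ?v + ?d j *\<^sub>R pd j \<phi> ?v))), 0))"
    unfolding cS pd2_field(2)[OF abc x] pd_field(2)[OF abc x]
    by (rule sum.cong) (simp_all add: ES scaleR_add_right mult.commute)
  also have "\<dots> = ((0, (b ?s / (sin ?s)\<^sup>2) *\<^sub>R diagonal_laplacian l \<phi> ?v), 0)"
    by (simp add: prod_eq_iff fst_sum snd_sum diagonal_laplacian_def scaleR_sum_right)
  also have "diagonal_laplacian l \<phi> ?v = - n *\<^sub>R \<phi> ?v"
    using diagonal_laplacian_orthogonal_sphere_param[OF param v] by (simp add: l_def[abs_def] n_def)
  finally have angular: "(\<Sum>j\<in>UNIV. (1 / E (Some j) x) *\<^sub>R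
      (pd (Some j) (pd (Some j) ?X) x + ?c (Some j) *\<^sub>R pd (Some j) ?X x)) =
      ((0, (b ?s / (sin ?s)\<^sup>2) *\<^sub>R (- n *\<^sub>R \<phi> ?v)), 0)" .
  show ?thesis
    unfolding diagonal_laplacian_def sum_option[of "\<lambda>k. (1 / E k x) *\<^sub>R _ k"] radial angular
    by (simp add: rotation_field_def scaleR_diff_left algebra_simps)
qed

text \<open>The trace of the shape operator, see \<open>mean_curvature_hypersurface\<close>.\<close>

definition "M s = deriv u s + n * u s * cot s"

lemma smooth_cot: "smooth_on I cot"
proof -
  have "smooth_on I (\<lambda>s. cos s / sin s)" by (intro smooth_on_divide open_I smooth_trig sin_nz)
  then show ?thesis by (simp add: cot_def[abs_def])
qed

lemma smooth_M: "smooth_on I M"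
  unfolding M_def[abs_def] by (intro smooth_intros open_I smooth_u smooth_cot)

lemma unit_deriv:
  assumes s: "s \<in> I"
  shows "u s * deriv u s + w s * deriv w s = 0"
    and "(deriv u s)\<^sup>2 + u s * deriv (deriv u) s + (deriv w s)\<^sup>2 + w s * deriv (deriv w) s = 0"
proof -
  note uw = smooth_u smooth_w
  note d = smooth_on_deriv[OF open_I uw(1)] smooth_on_deriv[OF open_I uw(2)]
  have D1: "((\<lambda>s. u s * u s + w s * w s) has_real_derivative 2 * (u t * deriv u t + w t * deriv w t)) (at t)"
    if "t \<in> I" for t
    using smooth_on_DERIV[OF uw(1) that] smooth_on_DERIV[OF uw(2) that]
    by (auto intro!: derivative_eq_intros)
  have one: "(\<lambda>s. u s * u s + w s * w s) = (\<lambda>s. 1)"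
    using unit by (simp add: fun_eq_iff power2_eq_square)
  have 1: "u t * deriv u t + w t * deriv w t = 0" if "t \<in> I" for t
    using DERIV_unique[OF D1[OF that, unfolded one] DERIV_const] by simp
  then show "u s * deriv u s + w s * deriv w s = 0" using s .
  have "deriv (\<lambda>s. u s * deriv u s + w s * deriv w s) s = deriv (\<lambda>s. 0) s"
    by (rule deriv_cong_open[OF open_I s]) (rule 1)
  moreover have "((\<lambda>s. u s * deriv u s + w s * deriv w s) has_real_derivative
     (deriv u s)\<^sup>2 + u s * deriv (deriv u) s + ((deriv w s)\<^sup>2 + w s * deriv (deriv w) s)) (at s)"
    using smooth_on_DERIV[OF uw(1) s] smooth_on_DERIV[OF uw(2) s]
      smooth_on_DERIV[OF d(1) s] smooth_on_DERIV[OF d(2) s]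
    by (auto intro!: derivative_eq_intros simp: power2_eq_square)
  ultimately show "(deriv u s)\<^sup>2 + u s * deriv (deriv u) s + (deriv w s)\<^sup>2 + w s * deriv (deriv w) s = 0"
    by (simp add: DERIV_imp_deriv)
qed

text \<open>In terms of the unit normal \<open>\<xi>\<close> and the position \<open>p\<close> in the sphere this says
  \<open>\<Delta>f = M \<xi> - (n + w\<^sup>2) (p, 0)\<close>. The coefficient \<open>n + w\<^sup>2\<close> is the squared norm of the
  differential of \<open>p\<close>.\<close>

lemma laplacian_hypersurface:
  assumes x: "x \<in> D"
  shows "diagonal_laplacian E (rotation_hypersurface h \<phi>) x =
    rotation_field \<phi> (\<lambda>s. M s * (u s * sin s) - (n + (w s)\<^sup>2) * cos s)
      (\<lambda>s. - (M s * (u s * cos s)) - (n + (w s)\<^sup>2) * sin s) (\<lambda>s. - (M s * w s)) x"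
proof -
  let ?s = "s_coord x"
  note s = domainD(1)[OF x]
  define S C where "S = sin ?s" and "C = cos ?s"
  have sin: "S \<noteq> 0" using sin_nz[OF s] by (simp add: S_def)
  have cot: "cot ?s = C / S" by (simp add: cot_def S_def C_def)
  have SC: "S\<^sup>2 + C\<^sup>2 = 1" by (simp add: S_def C_def)
  have dC: "deriv (\<lambda>s. - sin s) ?s = - C"
    by (rule DERIV_imp_deriv) (auto intro!: derivative_eq_intros simp: C_def)
  note uw = unit_deriv(1)[OF s] unit[of ?s]
  \<comment> \<open>With \<open>u\<^sup>2\<close> and \<open>u u'\<close> expressed through \<open>w\<close>, only \<open>M u\<close> has to be expanded.\<close>
  have uu: "u ?s * deriv u ?s = - (w ?s * deriv w ?s)" and u2: "(u ?s)\<^sup>2 = 1 - (w ?s)\<^sup>2"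
    using uw by linarith+
  have M: "M ?s * u ?s = - (w ?s * deriv w ?s) + n * (1 - (w ?s)\<^sup>2) * (C / S)"
    by (simp add: M_def cot flip: uu u2) (simp add: power2_eq_square algebra_simps)
  have "L cos ?s = M ?s * (u ?s * S) - (n + (w ?s)\<^sup>2) * C"
  proof -
    have "M ?s * (u ?s * S) = (M ?s * u ?s) * S" by simp
    also have "\<dots> = - (w ?s * deriv w ?s) * S + n * (1 - (w ?s)\<^sup>2) * C"
      unfolding M using sin by (simp add: field_simps)
    finally show ?thesis
      using sin by (simp add: radial_laplacian_def dC cot flip: S_def) (simp add: field_simps)
  qed
  moreover have "L sin ?s - n * S / S\<^sup>2 = - (M ?s * (u ?s * C)) - (n + (w ?s)\<^sup>2) * S"
  proof -
    have "M ?s * (u ?s * C) = (M ?s * u ?s) * C" by simp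
    also have "\<dots> = - (w ?s * deriv w ?s) * C + n * (1 - (w ?s)\<^sup>2) * (C\<^sup>2 / S)"
      unfolding M by (simp add: power2_eq_square algebra_simps)
    also have "C\<^sup>2 / S = 1 / S - S"
      using SC sin by (simp add: field_simps power2_eq_square)
    finally have MuC: "M ?s * (u ?s * C) = - (w ?s * deriv w ?s) * C + n * (1 - (w ?s)\<^sup>2) * (1 / S - S)" .
    have "L sin ?s - n * S / S\<^sup>2 = - (w ?s)\<^sup>2 * S + n * (w ?s)\<^sup>2 * (C\<^sup>2 / S) + w ?s * deriv w ?s * C - n * (1 / S)"
      using sin by (simp add: radial_laplacian_def cot power2_eq_square algebra_simps flip: S_def C_def)
    then show ?thesis
      unfolding MuC \<open>C\<^sup>2 / S = 1 / S - S\<close> by (simp add: algebra_simps)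
  qed
  moreover have "L h ?s = - (M ?s * w ?s)"
  proof -
    have dh: "deriv h t = - u t / w t" for t
      using w_pos[of t] by (simp add: u_eq)
    then have "deriv (deriv h) ?s = deriv (\<lambda>t. - u t / w t) ?s" by presburger
    also have "\<dots> = (- deriv u ?s * w ?s + u ?s * deriv w ?s) / (w ?s)\<^sup>2"
      by (rule DERIV_imp_deriv)
        (use w_pos[of ?s] smooth_on_DERIV[OF smooth_u s] smooth_on_DERIV[OF smooth_w s] in
          \<open>auto intro!: derivative_eq_intros simp: power2_eq_square diff_divide_distrib\<close>)
    finally have "(w ?s)\<^sup>2 * deriv (deriv h) ?s = - deriv u ?s * w ?s + u ?s * deriv w ?s"
      using w_pos[of ?s] by simp
    moreover have "deriv h ?s * w ?s = - u ?s" by (simp add: u_eq)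
    ultimately show ?thesis
      unfolding radial_laplacian_def M_def by algebra
  qed
  ultimately show ?thesis
    unfolding hypersurface_field laplacian_field[OF smooth_trig h x]
    by (simp add: rotation_field_def S_def C_def)
qed

lemma deriv_M:
  assumes s: "s \<in> I"
  shows "deriv M s = deriv (deriv u) s + n * deriv u s * cot s - n * u s * (1 + (cot s)\<^sup>2)"
proof -
  have "sin s \<noteq> 0" using sin_nz[OF s] .
  moreover have "(cos s)\<^sup>2 = 1 - (sin s)\<^sup>2" by (simp add: cos_squared_eq)
  ultimately have cot: "- inverse ((sin s)\<^sup>2) = - (1 + (cot s)\<^sup>2)"
    by (simp add: cot_def field_simps)
  have "(cot has_real_derivative - (1 + (cot s)\<^sup>2)) (at s)"
    using DERIV_cot[of s] sin_nz[OF s] unfolding cot by simp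
  then have "(M has_real_derivative deriv (deriv u) s + (n * deriv u s * cot s + n * u s * - (1 + (cot s)\<^sup>2))) (at s)"
    unfolding M_def[abs_def]
    using smooth_on_DERIV[OF smooth_u s] smooth_on_DERIV[OF smooth_on_deriv[OF open_I smooth_u] s]
    by (auto intro!: derivative_eq_intros)
  then show ?thesis by (simp add: DERIV_imp_deriv algebra_simps)
qed

text \<open>The two conclusions are the vertical and the horizontal component of the bitension field. Its
  components along the normal and along the profile curve are obtained by a rotation with the
  unit vector \<open>(u, w)\<close>; they are the two hypotheses, the one along the curve up to a factor \<open>w\<close>. As \<open>u\<^sup>2 + w\<^sup>2 = 1\<close>, the rotation can be
  undone.\<close>

lemma profile_equations:
  assumes s: "s \<in> I"
    and tangential: "(3 * deriv u s + n * u s * cot s) * deriv M s + 2 * n * u s * M s = 0"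
    and normal: "(1 - (u s)\<^sup>2) * deriv (deriv M) s
       + (n * (1 - (u s)\<^sup>2) * cot s - u s * deriv u s) * deriv M s
       + (n * (u s)\<^sup>2 * (1 - (cot s)\<^sup>2) - (deriv u s)\<^sup>2) * M s = 0"
  shows "L (\<lambda>s. M s * w s) s = 0"
    and "L (\<lambda>s. M s * u s) s + n * (1 - (cot s)\<^sup>2) * (M s * u s) = 0"
proof -
  define u0 u1 u2 where "u0 = u s" "u1 = deriv u s" "u2 = deriv (deriv u) s"
  define w0 w1 w2 where "w0 = w s" "w1 = deriv w s" "w2 = deriv (deriv w) s"
  define M0 M1 M2 where "M0 = M s" "M1 = deriv M s" "M2 = deriv (deriv M) s"
  define c where "c = cot s"
  note defs = u0_u1_u2_def w0_w1_w2_def M0_M1_M2_def c_def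
  define X where "X = w0\<^sup>2 * (M2 * w0 + 2 * (M1 * w1) + M0 * w2) + (n * c * w0\<^sup>2 + w0 * w1) * (M1 * w0 + M0 * w1)"
  define Y where "Y = w0\<^sup>2 * (M2 * u0 + 2 * (M1 * u1) + M0 * u2) + (n * c * w0\<^sup>2 + w0 * w1) * (M1 * u0 + M0 * u1)
    + n * (1 - c\<^sup>2) * (M0 * u0)"
  have X_eq: "L (\<lambda>s. M s * w s) s = X"
    by (simp add: radial_laplacian_def deriv_mult[OF smooth_M smooth_w s] deriv2_mult[OF open_I smooth_M smooth_w s] X_def defs)
  have Y_eq: "L (\<lambda>s. M s * u s) s + n * (1 - (cot s)\<^sup>2) * (M s * u s) = Y"
    by (simp add: radial_laplacian_def deriv_mult[OF smooth_M smooth_u s] deriv2_mult[OF open_I smooth_M smooth_u s] Y_def defs)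
  have H: "u0\<^sup>2 + w0\<^sup>2 = 1" "u0 * u1 + w0 * w1 = 0" "u1\<^sup>2 + u0 * u2 + w1\<^sup>2 + w0 * w2 = 0"
    using unit[of s] unit_deriv[OF s] by (simp_all add: defs)
  have M: "M0 = u1 + n * u0 * c" "M1 = u2 + n * u1 * c - n * u0 * (1 + c\<^sup>2)"
    using deriv_M[OF s] by (simp_all add: defs M_def)
  have G1: "(3 * u1 + n * u0 * c) * M1 + 2 * n * u0 * M0 = 0"
    using tangential by (simp add: defs)
  have G2: "(1 - u0\<^sup>2) * M2 + (n * (1 - u0\<^sup>2) * c - u0 * u1) * M1 + (n * u0\<^sup>2 * (1 - c\<^sup>2) - u1\<^sup>2) * M0 = 0"
    using normal by (simp add: defs)
  \<comment> \<open>\<open>P\<close> says that \<open>(u, w)\<close> turns with speed \<open>u' / w\<close>, and \<open>Q\<close> is its derivative.\<close>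
  have P: "w0 * (w0 * u1 - u0 * w1) = u1"
    using H(1,2) by algebra
  have Q: "w0 * (w0 * u2 - u0 * w2) = u2 - w1 * (w0 * u1 - u0 * w1)"
    using H by algebra
  have R: "w0\<^sup>2 * (u1\<^sup>2 + w1\<^sup>2) = u1\<^sup>2"
    using H(1,2) by algebra
  \<comment> \<open>The component along the profile curve.\<close>
  have "w0 * Y - u0 * X = w0 * (w0 * (w0 * u1 - u0 * w1)) * (2 * M1 + n * c * M0)
      + w0 * M0 * (w0 * (w0 * u2 - u0 * w2) + w1 * (w0 * u1 - u0 * w1)) + w0 * (n * (1 - c\<^sup>2) * (M0 * u0))"
    unfolding X_def Y_def by algebra
  also have "\<dots> = w0 * ((3 * u1 + n * u0 * c) * M1 + 2 * n * u0 * M0)"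
    unfolding P Q using M by algebra
  finally have "w0 * Y - u0 * X = 0" unfolding G1 by simp
  \<comment> \<open>The component along the normal.\<close>
  moreover have "u0 * Y + w0 * X = w0\<^sup>2 * M2 * (u0\<^sup>2 + w0\<^sup>2) + 2 * w0\<^sup>2 * M1 * (u0 * u1 + w0 * w1)
      + w0\<^sup>2 * M0 * (u0 * u2 + w0 * w2) + (n * c * w0\<^sup>2 + w0 * w1) * (M1 * (u0\<^sup>2 + w0\<^sup>2) + M0 * (u0 * u1 + w0 * w1))
      + n * (1 - c\<^sup>2) * M0 * u0\<^sup>2"
    unfolding X_def Y_def by algebra
  then have "u0 * Y + w0 * X = 0"
    using H R G2 by algebra
  ultimately have "(u0\<^sup>2 + w0\<^sup>2) * X = 0" "(u0\<^sup>2 + w0\<^sup>2) * Y = 0"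
    by algebra+
  then show "L (\<lambda>s. M s * w s) s = 0"
    and "L (\<lambda>s. M s * u s) s + n * (1 - (cot s)\<^sup>2) * (M s * u s) = 0"
    using H(1) X_eq Y_eq by simp_all
qed

text \<open>First order cross terms cancel between the two summands; differentiating the rotating frame
  twice leaves \<open>- w\<^sup>2 q\<close>.\<close>

lemma radial_laplacian_rotate:
  assumes q: "smooth_on I q" and s: "s \<in> I"
  shows "sin s * L (\<lambda>s. q s * sin s) s + cos s * L (\<lambda>s. q s * cos s) s = L q s - (w s)\<^sup>2 * q s"
proof -
  have dC: "deriv (\<lambda>s::real. - sin s) s = - cos s"
    by (rule DERIV_imp_deriv) (auto intro!: derivative_eq_intros)
  have SC: "(sin s)\<^sup>2 + (cos s)\<^sup>2 = 1" by simp
  show ?thesis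
    unfolding radial_laplacian_def deriv_mult[OF q smooth_trig(1) s] deriv2_mult[OF open_I q smooth_trig(1) s]
      deriv_mult[OF q smooth_trig(2) s] deriv2_mult[OF open_I q smooth_trig(2) s] deriv_trig dC
    using SC by algebra
qed

definition "tension_field = rotation_field \<phi> (\<lambda>s. (M s * u s) * sin s) (\<lambda>s. - ((M s * u s) * cos s)) (\<lambda>s. - (M s * w s))"

lemma tension_hypersurface:
  assumes x: "x \<in> D"
  shows "tangent_proj (rotation_hypersurface h \<phi> x) (diagonal_laplacian E (rotation_hypersurface h \<phi>) x) =
      tension_field x"
    and "fst (diagonal_laplacian E (rotation_hypersurface h \<phi>) x) \<bullet> fst (rotation_hypersurface h \<phi> x) =
      - (n + (w (s_coord x))\<^sup>2)"
proof -
  let ?s = "s_coord x"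
  let ?e = "n + (w ?s)\<^sup>2"
  have "fst (diagonal_laplacian E (rotation_hypersurface h \<phi>) x) \<bullet> fst (rotation_hypersurface h \<phi> x) =
      - ?e * ((sin ?s)\<^sup>2 + (cos ?s)\<^sup>2)"
    unfolding laplacian_hypersurface[OF x]
    by (simp add: rotation_field_def rotation_hypersurface_def \<phi>_unit[OF domainD(2)[OF x]]
        power2_eq_square algebra_simps del: sin_cos_squared_add sin_cos_squared_add2 sin_cos_squared_add3)
  then show r: "fst (diagonal_laplacian E (rotation_hypersurface h \<phi>) x) \<bullet> fst (rotation_hypersurface h \<phi> x) = - ?e"
    by simp
  show "tangent_proj (rotation_hypersurface h \<phi> x) (diagonal_laplacian E (rotation_hypersurface h \<phi>) x) =
      tension_field x"
    unfolding tangent_proj_def r unfolding laplacian_hypersurface[OF x]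
    by (simp add: rotation_field_def rotation_hypersurface_def tension_field_def algebra_simps)
qed

text \<open>With \<open>T = M \<xi>\<close> the vector in \<open>biharmonic_map_criterion\<close> is again a rotation field. Its component
  along the line vanishes by the first profile equation. The remaining components \<open>A\<close> and
  \<open>B \<phi>\<close> are normal to the sphere if and only if \<open>A sin s = B cos s\<close>, which is the second one.\<close>

lemma biharmonic:
  assumes tangential: "\<And>s. s \<in> I \<Longrightarrow> (3 * deriv u s + n * u s * cot s) * deriv M s + 2 * n * u s * M s = 0"
    and normal: "\<And>s. s \<in> I \<Longrightarrow> (1 - (u s)\<^sup>2) * deriv (deriv M) s
       + (n * (1 - (u s)\<^sup>2) * cot s - u s * deriv u s) * deriv M s
       + (n * (u s)\<^sup>2 * (1 - (cot s)\<^sup>2) - (deriv u s)\<^sup>2) * M s = 0"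
  shows "biharmonic_hypersurface D (rotation_hypersurface h \<phi>)"
  unfolding biharmonic_hypersurface_def
proof (intro conjI immersed biharmonic_map_criterion)
  show "smooth_on D (rotation_hypersurface h \<phi>)" "rotation_hypersurface h \<phi> ` D \<subseteq> sphere_line"
    using immersed by (auto simp: immersed_hypersurface_def)
  fix x assume x: "x \<in> D"
  let ?f = "rotation_hypersurface h \<phi>"
  let ?s = "s_coord x"
  let ?e = "n + (w ?s)\<^sup>2"
  let ?q = "\<lambda>s. M s * u s"
  note s = domainD(1)[OF x]
  note eqs = profile_equations[OF s tangential[OF s] normal[OF s]]
  have q: "smooth_on I ?q" and qS: "smooth_on I (\<lambda>s. ?q s * sin s)" and qC: "smooth_on I (\<lambda>s. ?q s * cos s)"
    and Mw: "smooth_on I (\<lambda>s. M s * w s)"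
    by (intro smooth_on_mult open_I smooth_M smooth_u smooth_w smooth_trig)+
  have "diagonal_laplacian E (\<lambda>x. tangent_proj (?f x) (diagonal_laplacian E ?f x)) x =
      diagonal_laplacian E tension_field x"
    by (rule diagonal_laplacian_cong[OF open_D x]) (rule tension_hypersurface(1))
  also have "\<dots> = ((L (\<lambda>s. ?q s * sin s) ?s,
      (- L (\<lambda>s. ?q s * cos s) ?s + n * (?q ?s * cos ?s) / (sin ?s)\<^sup>2) *\<^sub>R \<phi> (v_coord x)), 0)"
    unfolding tension_field_def
      laplacian_field[OF qS smooth_on_minus[OF open_I qC] smooth_on_minus[OF open_I Mw] x]
    using eqs(1) by (simp add: rotation_field_def radial_laplacian_minus[OF qC s] radial_laplacian_minus[OF Mw s])
  finally have lap: "diagonal_laplacian E (\<lambda>x. tangent_proj (?f x) (diagonal_laplacian E ?f x)) x = \<dots>" .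
  define A where "A = L (\<lambda>s. ?q s * sin s) ?s + ?e * (?q ?s * sin ?s)"
  define B where "B = - L (\<lambda>s. ?q s * cos s) ?s + n * (?q ?s * cos ?s) / (sin ?s)\<^sup>2 - ?e * (?q ?s * cos ?s)"
  have AB: "A * sin ?s = B * cos ?s"
  proof -
    have "A * sin ?s - B * cos ?s = (sin ?s * L (\<lambda>s. ?q s * sin s) ?s + cos ?s * L (\<lambda>s. ?q s * cos s) ?s)
        + ?e * ?q ?s * ((sin ?s)\<^sup>2 + (cos ?s)\<^sup>2) - n * ?q ?s * (cos ?s / sin ?s)\<^sup>2"
      by (simp add: A_def B_def algebra_simps power2_eq_square
          del: sin_cos_squared_add sin_cos_squared_add2 sin_cos_squared_add3)
    also have "\<dots> = L ?q ?s + n * (1 - (cot ?s)\<^sup>2) * ?q ?s"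
      unfolding radial_laplacian_rotate[OF q s] by (simp add: cot_def algebra_simps)
    also have "\<dots> = 0" by (rule eqs(2))
    finally show ?thesis by simp
  qed
  have SC: "sin ?s * sin ?s + cos ?s * cos ?s = 1"
    using sin_cos_squared_add[of ?s] by (simp add: power2_eq_square)
  have "A = (A * cos ?s + sin ?s * B) * cos ?s" "B = (A * cos ?s + sin ?s * B) * sin ?s"
    using AB SC by algebra+
  then have "tangent_proj (?f x) ((A, B *\<^sub>R \<phi> (v_coord x)), 0) = 0"
    using \<phi>_unit[OF domainD(2)[OF x]]
    by (simp add: tangent_proj_def rotation_hypersurface_def inner_prod_def zero_prod_def)
  moreover have "diagonal_laplacian E (\<lambda>x. tangent_proj (?f x) (diagonal_laplacian E ?f x)) x -
      (fst (diagonal_laplacian E ?f x) \<bullet> fst (?f x)) *\<^sub>R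
        (fst (tangent_proj (?f x) (diagonal_laplacian E ?f x)), 0) = ((A, B *\<^sub>R \<phi> (v_coord x)), 0)"
    unfolding lap tension_hypersurface[OF x]
    by (simp add: tension_field_def rotation_field_def A_def B_def algebra_simps)
  ultimately show "tangent_proj (?f x)
      (diagonal_laplacian E (\<lambda>x. tangent_proj (?f x) (diagonal_laplacian E ?f x)) x -
      (fst (diagonal_laplacian E ?f x) \<bullet> fst (?f x)) *\<^sub>R
        (fst (tangent_proj (?f x) (diagonal_laplacian E ?f x)), 0)) = 0"
    by simp
qed

lemma normal_field: "rotation_normal h \<phi> = rotation_field \<phi> (\<lambda>s. u s * sin s) (\<lambda>s. - (u s * cos s)) (\<lambda>s. - w s)"
  by (simp add: fun_eq_iff rotation_normal_def rotation_field_def profile_u_def profile_w_def Let_def)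

text \<open>The derivatives of \<open>f\<close> are orthogonal to the normal field \<open>\<xi>\<close>, so the trace of the shape
  operator is \<open>\<Delta>f \<bullet> \<xi>\<close>.\<close>

lemma mean_curvature_hypersurface:
  assumes x: "x \<in> D"
  shows "mean_curvature (rotation_hypersurface h \<phi>) (rotation_normal h \<phi>) x = M (s_coord x) / (n + 1)"
proof -
  let ?f = "rotation_hypersurface h \<phi>" and ?\<xi> = "rotation_normal h \<phi> x"
  let ?s = "s_coord x"
  note v = domainD(2)[OF x]
  have \<xi>p: "fst (?f x) \<bullet> fst ?\<xi> = 0"
    using \<phi>_unit[OF v] by (simp add: normal_field rotation_field_def rotation_hypersurface_def)
  have proj: "tangent_proj (?f x) Y \<bullet> ?\<xi> = Y \<bullet> ?\<xi>" for Y
    using \<xi>p by (cases ?\<xi>; cases Y) (simp add: tangent_proj_def inner_diff_left)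
  have \<xi>_tan: "pd k ?f x \<bullet> ?\<xi> = 0" for k
  proof (cases k)
    case None
    have "pd None ?f x \<bullet> ?\<xi> = - (u ?s * ((sin ?s)\<^sup>2 + (cos ?s)\<^sup>2)) - deriv h ?s * w ?s"
      using \<phi>_unit[OF v]
      by (simp add: pd_hypersurface[OF x] normal_field rotation_field_def power2_eq_square algebra_simps
          del: sin_cos_squared_add sin_cos_squared_add2 sin_cos_squared_add3)
    then show ?thesis by (simp add: None u_eq)
  next
    case (Some i)
    then show ?thesis
      using \<phi>_tangent[OF v, of i]
      by (simp add: pd_hypersurface[OF x] normal_field rotation_field_def inner_commute)
  qed
  have "trace (shape_operator ?f (rotation_normal h \<phi>) x) =
      (\<Sum>i\<in>UNIV. (1 / E i x) * (tangent_proj (?f x) (pd i (pd i ?f) x) \<bullet> ?\<xi>))"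
    by (simp add: trace_def shape_operator_def matrix_matrix_mult_def matrix_inv_metric[OF x]
        if_distrib[of "\<lambda>a. a * _"] cong: if_cong)
  also have "\<dots> = diagonal_laplacian E ?f x \<bullet> ?\<xi>"
    by (simp add: diagonal_laplacian_def inner_sum_left inner_add_left \<xi>_tan proj)
  also have "\<dots> = M ?s * ((u ?s)\<^sup>2 * ((sin ?s)\<^sup>2 + (cos ?s)\<^sup>2) + (w ?s)\<^sup>2)"
    using \<phi>_unit[OF v]
    by (simp add: laplacian_hypersurface[OF x] normal_field rotation_field_def power2_eq_square algebra_simps
        del: sin_cos_squared_add sin_cos_squared_add2 sin_cos_squared_add3)
  also have "\<dots> = M ?s" using unit[of ?s] by simp
  finally show ?thesis by (simp add: mean_curvature_def n_def)
qed

end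


section \<open>The biharmonicity criterion for rotation hypersurfaces\<close>

theorem theorem3p3:
  fixes h \<alpha> u H :: "real \<Rightarrow> real"
    and \<phi> :: "real^'n::finite \<Rightarrow> real^('n option)"
    and I :: "real set" and V :: "(real^'n) set"
    and m :: nat
  assumes "m = CARD('n option)"
    and "open I" and "\<forall>s\<in>I. sin s \<noteq> 0"
    and "smooth_on I h"
    and "orthogonal_sphere_param V \<phi>"
    and "angle_function I V h \<phi> \<alpha>"
    and "\<forall>s\<in>I. u s = - sin (\<alpha> s)"
    and "\<forall>s\<in>I. H s = 1 / real m * (deriv u s + (real m - 1) * u s * cot s)"
  shows "(\<forall>x\<in>rotation_domain I V.
            mean_curvature (rotation_hypersurface h \<phi>) (rotation_normal h \<phi>) x = H (s_coord x)) \<and>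
         ((\<forall>s\<in>I. (3 * deriv u s + (real m - 1) * u s * cot s) * deriv H s
                   + 2 * (real m - 1) * u s * H s = 0) \<and>
          (\<forall>s\<in>I. (1 - (u s)\<^sup>2) * deriv (deriv H) s
                   + ((real m - 1) * (1 - (u s)\<^sup>2) * cot s - u s * deriv u s) * deriv H s
                   + ((real m - 1) * (u s)\<^sup>2 * (1 - (cot s)\<^sup>2) - (deriv u s)\<^sup>2) * H s = 0)
          \<longrightarrow> biharmonic_hypersurface (rotation_domain I V) (rotation_hypersurface h \<phi>))"
proof -
  define n where "n = real CARD('n)"
  have m: "real m = n + 1" using assms(1) by (simp add: n_def)
  interpret rotation I V h \<phi> n
    by unfold_locales (use assms n_def in auto)
  \<comment> \<open>On the open set \<open>I\<close> the given functions agree with the smooth ones built from \<open>h'\<close>, hence so do their derivatives.\<close>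
  have u: "u s = profile_u h s" if "s \<in> I" for s
    using assms(6,7) that by (simp add: angle_function_def profile_u_def)
  have du: "deriv u s = deriv (profile_u h) s" if "s \<in> I" for s
    using deriv_cong_open[OF open_I that u] .
  have H: "H s = M s / (n + 1)" if "s \<in> I" for s
    using assms(8) that by (simp add: M_def m u du)
  have n: "n + 1 \<noteq> 0" by (simp add: n_def)
  have dH: "deriv H s = deriv M s / (n + 1)" if s: "s \<in> I" for s
  proof -
    have "deriv H s = deriv (\<lambda>s. M s / (n + 1)) s"
      by (rule deriv_cong_open[OF open_I s]) (rule H)
    also have "\<dots> = deriv M s / (n + 1)"
      by (rule DERIV_imp_deriv) (rule DERIV_cdivide[OF smooth_on_DERIV[OF smooth_M s]])
    finally show ?thesis .
  qed
  have ddH: "deriv (deriv H) s = deriv (deriv M) s / (n + 1)" if s: "s \<in> I" for s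
  proof -
    have "deriv (deriv H) s = deriv (\<lambda>s. deriv M s / (n + 1)) s"
      by (rule deriv_cong_open[OF open_I s]) (rule dH)
    also have "\<dots> = deriv (deriv M) s / (n + 1)"
      by (rule DERIV_imp_deriv)
        (rule DERIV_cdivide[OF smooth_on_DERIV[OF smooth_on_deriv[OF open_I smooth_M] s]])
    finally show ?thesis .
  qed
  show ?thesis
  proof (intro conjI impI ballI)
    fix x assume "x \<in> rotation_domain I V"
    then show "mean_curvature (rotation_hypersurface h \<phi>) (rotation_normal h \<phi>) x = H (s_coord x)"
      using mean_curvature_hypersurface H[OF domainD(1)] by simp
  next
    assume eqs: "(\<forall>s\<in>I. (3 * deriv u s + (real m - 1) * u s * cot s) * deriv H s
                   + 2 * (real m - 1) * u s * H s = 0) \<and>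
          (\<forall>s\<in>I. (1 - (u s)\<^sup>2) * deriv (deriv H) s
                   + ((real m - 1) * (1 - (u s)\<^sup>2) * cot s - u s * deriv u s) * deriv H s
                   + ((real m - 1) * (u s)\<^sup>2 * (1 - (cot s)\<^sup>2) - (deriv u s)\<^sup>2) * H s = 0)"
    have m1: "real m - 1 = n" using m by simp
    show "biharmonic_hypersurface (rotation_domain I V) (rotation_hypersurface h \<phi>)"
    proof (rule biharmonic)
      fix s assume s: "s \<in> I"
      have "((3 * deriv (profile_u h) s + n * profile_u h s * cot s) * deriv M s + 2 * n * profile_u h s * M s)
          / (n + 1) = 0"
        unfolding add_divide_distrib using eqs s unfolding m1 by (simp add: u du H dH)
      then show "(3 * deriv (profile_u h) s + n * profile_u h s * cot s) * deriv M s + 2 * n * profile_u h s * M s = 0"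
        using n by simp
      have "((1 - (profile_u h s)\<^sup>2) * deriv (deriv M) s
         + (n * (1 - (profile_u h s)\<^sup>2) * cot s - profile_u h s * deriv (profile_u h) s) * deriv M s
         + (n * (profile_u h s)\<^sup>2 * (1 - (cot s)\<^sup>2) - (deriv (profile_u h) s)\<^sup>2) * M s) / (n + 1) = 0"
        unfolding add_divide_distrib using eqs s unfolding m1 by (simp add: u du H dH ddH)
      then show "(1 - (profile_u h s)\<^sup>2) * deriv (deriv M) s
         + (n * (1 - (profile_u h s)\<^sup>2) * cot s - profile_u h s * deriv (profile_u h) s) * deriv M s
         + (n * (profile_u h s)\<^sup>2 * (1 - (cot s)\<^sup>2) - (deriv (profile_u h) s)\<^sup>2) * M s = 0"
        using n by simp
    qed
  qed
qed

end
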